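(* Let $f\colon\mathbb{R}\to\mathbb{C}$ be periodic with period $1$ and absolutely integrable over one period, and let $g\colon\mathbb{R}\to\mathbb{C}$ with $g\in L^{1}(\mathbb{R})$. Suppose that there exists some $A>0$ such that $\operatorname{supp} g\subset[-A,A]$, and that for every $n\in\mathbb{Z}$ with $|n|\leq A$ the function $g$ is of bounded variation in a neighborhood of $n$. Then $$\int_{-\infty}^{\infty}f(x)\hat{g}(x)\,dx=\sum_{\substack{n\in\mathbb{Z}\\ |n|\leq A}}\hat{f}(n)\cdot\frac{g(n^{-})+g(n^{+})}{2}.$$
   Context: For $g\in L^1(\mathbb{R})$ the Fourier transform is $\hat g(\xi)=\int_{-\infty}^{\infty}g(x)e^{-2\pi i x\xi}\,dx$. For a $1$-periodic function $f$ integrable over a period, the Fourier coefficients are $\hat f(n)=\int_{-1/2}^{1/2}e^{-2\pi i n x}f(x)\,dx$, $n\in\mathbb{Z}$. One-sided limits are $g(x^-)=\lim_{\varepsilon\searrow 0}g(x-\varepsilon)$ and $g(x^+)=\lim_{\varepsilon\searrow 0}g(x+\varepsilon)$. The integral over $\mathbb{R}$ on the left-hand side of the claim need not converge absolutely; it is understood as the symmetric improper integral $\lim_{R\to\infty}\int_{-R}^{R}$, and the claim includes that this limit exists. *)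

theory Defs
  imports "HOL-Analysis.Analysis"
begin

definition fourier_transform :: "(real \<Rightarrow> complex) \<Rightarrow> real \<Rightarrow> complex" where
  "fourier_transform g \<xi> =
     (LINT x|lebesgue. g x * exp (- (2 * complex_of_real pi * \<i> * complex_of_real x * complex_of_real \<xi>)))"

definition fourier_coeff :: "(real \<Rightarrow> complex) \<Rightarrow> int \<Rightarrow> complex" where
  "fourier_coeff f n =
     (LINT x:{-1/2..1/2}|lebesgue. exp (- (2 * complex_of_real pi * \<i> * of_int n * complex_of_real x)) * f x)"

text \<open>Bounded variation in the classical pointwise sense: the variation sums over all finite
  increasing sequences of points of \<open>S\<close> have a common upper bound.\<close>

definition bounded_variation_on :: "(real \<Rightarrow> 'a::real_normed_vector) \<Rightarrow> real set \<Rightarrow> bool" where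
  "bounded_variation_on g S \<longleftrightarrow>
     (\<exists>B. \<forall>(m::nat) t. mono_on {..m} t \<and> t ` {..m} \<subseteq> S \<longrightarrow>
            (\<Sum>i<m. norm (g (t (Suc i)) - g (t i))) \<le> B)"

definition locally_bounded_variation_at :: "(real \<Rightarrow> 'a::real_normed_vector) \<Rightarrow> real \<Rightarrow> bool" where
  "locally_bounded_variation_at g x \<longleftrightarrow> (\<exists>\<delta>>0. bounded_variation_on g {x - \<delta>..x + \<delta>})"

definition left_lim :: "(real \<Rightarrow> 'a::t2_space) \<Rightarrow> real \<Rightarrow> 'a" where
  "left_lim g x = Lim (at_left x) g"

definition right_lim :: "(real \<Rightarrow> 'a::t2_space) \<Rightarrow> real \<Rightarrow> 'a" where
  "right_lim g x = Lim (at_right x) g"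

text \<open>The symmetric improper integral. The Bochner integral of a non-integrable function is \<open>0\<close>,
  so integrability over every bounded symmetric interval is required explicitly.\<close>

definition has_symmetric_integral ::
    "(real \<Rightarrow> 'a::euclidean_space) \<Rightarrow> 'a \<Rightarrow> bool" (infixr \<open>has'_symmetric'_integral\<close> 46) where
  "(h has_symmetric_integral I) \<longleftrightarrow>
     (\<forall>R. h absolutely_integrable_on {-R..R}) \<and>
     ((\<lambda>R. LINT x:{-R..R}|lebesgue. h x) \<longlongrightarrow> I) at_top"

end

theory Submission
  imports Defs "HOL-Probability.Sinc_Integral"
begin

text \<open>
Truncate \<open>f\<close> to the interval from \<open>- (N + 1/2)\<close> to \<open>N + 1/2\<close>. The multiplication formula (Fubini)
turns the integral of \<open>f\<close> against the transform of \<open>g\<close> into the integral of \<open>g\<close> against the transform of the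
truncated \<open>f\<close>. Because the interval consists of \<open>2N + 1\<close> whole periods, that transform is
\<open>D\<^sub>N \<phi>\<close>, where \<open>D\<^sub>N\<close> is the Dirichlet kernel and \<open>\<phi>\<close> is the transform of a single period of \<open>f\<close>;
so \<open>\<phi>\<close> is a Lipschitz function, and its value at an integer is the Fourier coefficient of \<open>f\<close> there.

It remains to see that \<open>\<integral> g D\<^sub>N \<phi>\<close> tends to the sum of \<open>\<phi>(n) (g(n-) + g(n+)) / 2\<close>
(\<open>dirichlet_kernel_convergence\<close>). With \<open>\<lambda> = (2N + 1)\<pi>\<close> one has \<open>D\<^sub>N(y) = sin (\<lambda>y) / sin (\<pi>y)\<close>, and close
to \<open>n\<close> the function \<open>D\<^sub>N(y) \<phi>(y)\<close> is \<open>\<phi>(n) sin (\<lambda>(y - n)) / (\<pi>(y - n))\<close> plus \<open>sin (\<lambda>y)\<close> times a bounded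
function, by the Lipschitz property of \<open>\<phi>\<close> (\<open>singular_quotient_bound\<close>). The bounded part contributes nothing in
the limit by the Riemann-Lebesgue lemma. The singular part is the classical integral of Dirichlet and
Jordan (\<open>dirichlet_jordan\<close>): near \<open>n\<close> the function \<open>g\<close> is a combination of monotone functions, and for
those the second mean value theorem together with \<open>Si(x) \<rightarrow> \<pi>/2\<close> yields the average of the one-sided
limits.

Finally an arbitrary \<open>R\<close> differs from some \<open>N + 1/2\<close> by less than one period. On each of the two pieces
left over the integral is at most the supremum of the modulus of the transform of \<open>g\<close> there times the integral of
\<open>|f|\<close> over a period, and this transform vanishes at infinity, again by Riemann-Lebesgue (\<open>tendsto_symmetric_integral_periodic\<close>).
\<close>

section \<open>Fourier transforms of integrable functions\<close>

lemma fourier_transform_cis: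
  "fourier_transform g \<xi> = (LINT x|lebesgue. g x * cis (- (2 * pi * x * \<xi>)))"
  unfolding fourier_transform_def by (simp add: cis_conv_exp mult_ac)

lemma cis_measurable [measurable]: "cis \<in> borel_measurable borel"
  by (intro borel_measurable_continuous_onI continuous_intros)

lemma lebesgue_measurable_of_borel:
  "h \<in> borel_measurable borel \<Longrightarrow> h \<in> borel_measurable lebesgue"
  by (rule measurable_completion) simp

lemma integrable_bounded_factor:
  fixes h k :: "'a \<Rightarrow> complex"
  assumes h: "integrable M h" and k: "k \<in> borel_measurable M" and b: "\<And>x. norm (k x) \<le> B"
  shows "integrable M (\<lambda>x. h x * k x)"
proof (rule Bochner_Integration.integrable_bound)
  show "integrable M (\<lambda>x. of_real B * h x)" using h by simp
  show "(\<lambda>x. h x * k x) \<in> borel_measurable M" using h k by measurable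
  show "AE x in M. norm (h x * k x) \<le> norm (of_real B * h x)"
  proof (rule AE_I2)
    fix x
    have "norm (k x) * norm (h x) \<le> \<bar>B\<bar> * norm (h x)"
      using b[of x] by (intro mult_right_mono) auto
    then show "norm (h x * k x) \<le> norm (of_real B * h x)"
      by (simp add: norm_mult mult.commute)
  qed
qed

lemma integrable_fourier_integrand:
  assumes "integrable lebesgue h"
  shows "integrable lebesgue (\<lambda>x. h x * cis (- (2 * pi * x * \<xi>)))"
  using assms
  by (rule integrable_bounded_factor[where B = 1])
     (auto intro!: lebesgue_measurable_of_borel)

text \<open>The product measure used by Fubini's theorem is built from \<open>lborel\<close>, whereas Lebesgue measurable functions live
  on its completion. Passing to an almost everywhere equal Borel function bridges the two.\<close>

lemma borel_representative:
  fixes h :: "real \<Rightarrow> complex"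
  assumes h: "integrable lebesgue h"
  obtains h' where "integrable lborel h'" "AE x in lebesgue. h x = h' x"
proof -
  have "(\<lambda>x. Re (h x)) \<in> borel_measurable lebesgue" "(\<lambda>x. Im (h x)) \<in> borel_measurable lebesgue"
    using h by simp_all
  then obtain p q where p: "p \<in> borel_measurable lborel" "AE x in lborel. Re (h x) = p x"
    and q: "q \<in> borel_measurable lborel" "AE x in lborel. Im (h x) = q x"
    using completion_ex_borel_measurable_real by metis
  define h' where "h' x = Complex (p x) (q x)" for x
  have m: "h' \<in> borel_measurable lborel"
    using p(1) q(1) by (subst borel_measurable_complex_iff) (auto simp: h'_def)
  have ae: "AE x in lebesgue. h x = h' x"
    using AE_completion[OF p(2)] AE_completion[OF q(2)]
    by eventually_elim (simp add: h'_def complex_eq_iff)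
  have "integrable lebesgue h'"
    using h ae m by (subst integrable_cong_AE[where g = h]) (auto intro!: measurable_completion)
  then have "integrable lborel h'" using m by (simp add: integrable_completion)
  then show ?thesis using that ae by blast
qed

lemma fourier_transform_borel_representative:
  assumes h: "integrable lebesgue h" and h': "integrable lborel h'" and ae: "AE x in lebesgue. h x = h' x"
  shows "fourier_transform h \<xi> = (LINT x|lborel. h' x * cis (- (2 * pi * x * \<xi>)))"
proof -
  have m: "(\<lambda>x. h' x * cis (- (2 * pi * x * \<xi>))) \<in> borel_measurable lborel"
    using h' by measurable
  have "fourier_transform h \<xi> = (LINT x|lebesgue. h' x * cis (- (2 * pi * x * \<xi>)))"
    unfolding fourier_transform_cis
  proof (rule integral_cong_AE)
    show "(\<lambda>x. h x * cis (- (2 * pi * x * \<xi>))) \<in> borel_measurable lebesgue"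
      by (rule borel_measurable_integrable[OF integrable_fourier_integrand[OF h]])
    show "(\<lambda>x. h' x * cis (- (2 * pi * x * \<xi>))) \<in> borel_measurable lebesgue"
      using m by (rule measurable_completion)
  qed (use ae in eventually_elim, simp)
  also have "\<dots> = (LINT x|lborel. h' x * cis (- (2 * pi * x * \<xi>)))"
    using m by (rule integral_completion)
  finally show ?thesis .
qed

text \<open>Both sides are iterated integrals of \<open>f(x) g(y) exp (-2\<pi>ixy)\<close>, whose modulus
  \<open>|f(x)| |g(y)|\<close> is integrable on the plane; Fubini's theorem exchanges them.\<close>

lemma multiplication_formula:
  assumes f: "integrable lebesgue f" and g: "integrable lebesgue g"
  shows "integrable lebesgue (\<lambda>x. f x * fourier_transform g x)"
    and "(LINT x|lebesgue. f x * fourier_transform g x) = (LINT y|lebesgue. g y * fourier_transform f y)"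
proof -
  obtain f' where f': "integrable lborel f'" "AE x in lebesgue. f x = f' x"
    using borel_representative[OF f] .
  obtain g' where g': "integrable lborel g'" "AE x in lebesgue. g x = g' x"
    using borel_representative[OF g] .
  have [measurable]: "f' \<in> borel_measurable borel" "g' \<in> borel_measurable borel"
    using f'(1) g'(1) by auto
  define k where "k = (\<lambda>x y. f' x * g' y * cis (- (2 * pi * x * y)))"
  have k: "integrable (lborel \<Otimes>\<^sub>M lborel) (case_prod k)"
  proof (rule lborel_pair.Fubini_integrable)
    show "case_prod k \<in> borel_measurable (lborel \<Otimes>\<^sub>M lborel)"
      unfolding k_def by measurable
    have "(\<lambda>x. LINT y|lborel. norm (case_prod k (x, y))) = (\<lambda>x. norm (f' x) * (LINT y|lborel. norm (g' y)))"
      by (simp add: k_def norm_mult)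
    then show "integrable lborel (\<lambda>x. LINT y|lborel. norm (case_prod k (x, y)))"
      using f'(1) by simp
    show "AE x in lborel. integrable lborel (\<lambda>y. case_prod k (x, y))"
    proof (rule AE_I2)
      fix x :: real
      have "integrable lborel (\<lambda>y. g' y * (f' x * cis (- (2 * pi * x * y))))"
        by (rule integrable_bounded_factor[OF g'(1), where B = "norm (f' x)"]) (auto simp: norm_mult)
      then show "integrable lborel (\<lambda>y. case_prod k (x, y))"
        by (simp add: k_def mult_ac)
    qed
  qed
  have Fg: "fourier_transform g x = (LINT y|lborel. g' y * cis (- (2 * pi * x * y)))" for x
    using fourier_transform_borel_representative[OF g g'] by (simp add: mult_ac)
  have Ff: "fourier_transform f y = (LINT x|lborel. f' x * cis (- (2 * pi * x * y)))" for y
    using fourier_transform_borel_representative[OF f f'] .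
  have fk: "(\<lambda>x. f' x * fourier_transform g x) = (\<lambda>x. LINT y|lborel. k x y)"
    unfolding k_def mult.assoc Fg by simp
  have gk: "(\<lambda>y. g' y * fourier_transform f y) = (\<lambda>y. LINT x|lborel. k x y)"
  proof
    fix y
    have "(LINT x|lborel. k x y) = (LINT x|lborel. g' y * (f' x * cis (- (2 * pi * x * y))))"
      by (simp add: k_def mult_ac)
    then show "g' y * fourier_transform f y = (LINT x|lborel. k x y)"
      unfolding Ff by simp
  qed
  have ifk: "integrable lborel (\<lambda>x. f' x * fourier_transform g x)"
    unfolding fk using lborel_pair.integrable_fst[OF k] .
  have igk: "integrable lborel (\<lambda>y. g' y * fourier_transform f y)"
    unfolding gk using lborel_pair.integrable_snd[OF k] .
  have mf: "(\<lambda>x. fourier_transform f x) \<in> borel_measurable lborel"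
    unfolding Ff by measurable
  have mg: "(\<lambda>x. fourier_transform g x) \<in> borel_measurable lborel"
    unfolding Fg by measurable
  have aef: "AE x in lebesgue. f x * fourier_transform g x = f' x * fourier_transform g x"
    using f'(2) by eventually_elim simp
  have aeg: "AE x in lebesgue. g x * fourier_transform f x = g' x * fourier_transform f x"
    using g'(2) by eventually_elim simp
  have meas: "(\<lambda>x. f x * fourier_transform g x) \<in> borel_measurable lebesgue"
     "(\<lambda>x. f' x * fourier_transform g x) \<in> borel_measurable lebesgue"
     "(\<lambda>x. g x * fourier_transform f x) \<in> borel_measurable lebesgue"
     "(\<lambda>x. g' x * fourier_transform f x) \<in> borel_measurable lebesgue"
    using f g measurable_completion[OF mf] measurable_completion[OF mg]
      measurable_completion[OF borel_measurable_integrable[OF f'(1)]] 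
      measurable_completion[OF borel_measurable_integrable[OF g'(1)]] by auto
  show "integrable lebesgue (\<lambda>x. f x * fourier_transform g x)"
    using ifk aef meas
    by (subst integrable_cong_AE[OF _ _ aef]) (auto simp: integrable_completion)
  have "(LINT x|lebesgue. f x * fourier_transform g x) = (LINT x|lborel. f' x * fourier_transform g x)"
    using ifk by (subst integral_cong_AE[OF _ _ aef]) (auto simp: meas integral_completion)
  also have "\<dots> = (LINT y|lborel. g' y * fourier_transform f y)"
    unfolding fk gk by (rule lborel_pair.Fubini_integral[OF k, symmetric])
  also have "\<dots> = (LINT y|lebesgue. g y * fourier_transform f y)"
    using igk by (subst integral_cong_AE[OF _ _ aeg]) (auto simp: meas integral_completion)
  finally show "(LINT x|lebesgue. f x * fourier_transform g x) = (LINT y|lebesgue. g y * fourier_transform f y)" .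
qed

section \<open>The Riemann-Lebesgue lemma\<close>

lemma fourier_transform_cmult:
  "fourier_transform (\<lambda>x. c * h x) \<xi> = c * fourier_transform h \<xi>"
  unfolding fourier_transform_cis by (simp add: mult.assoc)

lemma fourier_transform_diff:
  assumes "integrable lebesgue h" "integrable lebesgue k"
  shows "fourier_transform (\<lambda>x. h x - k x) \<xi> = fourier_transform h \<xi> - fourier_transform k \<xi>"
  unfolding fourier_transform_cis
  by (simp add: left_diff_distrib integrable_fourier_integrand assms)

lemma fourier_transform_add:
  assumes "integrable lebesgue h" "integrable lebesgue k"
  shows "fourier_transform (\<lambda>x. h x + k x) \<xi> = fourier_transform h \<xi> + fourier_transform k \<xi>"
  unfolding fourier_transform_cis
  by (simp add: distrib_right integrable_fourier_integrand assms)

text \<open>The functions whose transform vanishes at infinity are closed in \<open>L\<^sup>1\<close>, since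
  the transforms of two functions differ at every point by at most their \<open>L\<^sup>1\<close> distance.\<close>

lemma fourier_transform_L1_approx:
  assumes h: "integrable lebesgue h" and s: "\<And>i. integrable lebesgue (s i)"
    and RL: "\<And>i::nat. (fourier_transform (s i) \<longlongrightarrow> 0) at_infinity"
    and lim: "(\<lambda>i. LINT x|lebesgue. norm (h x - s i x)) \<longlonglongrightarrow> 0"
  shows "(fourier_transform h \<longlongrightarrow> 0) at_infinity"
proof (rule tendstoI)
  fix e :: real assume "e > 0"
  then obtain i where i: "(LINT x|lebesgue. norm (h x - s i x)) < e / 2"
    using order_tendstoD(2)[OF lim, of "e / 2"] by (auto simp: eventually_sequentially)
  have close: "norm (fourier_transform h \<xi> - fourier_transform (s i) \<xi>)
      \<le> (LINT x|lebesgue. norm (h x - s i x))" for \<xi>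
  proof -
    have "norm (fourier_transform (\<lambda>x. h x - s i x) \<xi>)
        \<le> (LINT x|lebesgue. norm ((h x - s i x) * cis (- (2 * pi * x * \<xi>))))"
      unfolding fourier_transform_cis by (rule integral_norm_bound)
    then show ?thesis by (simp add: norm_mult fourier_transform_diff h s)
  qed
  have "\<forall>\<^sub>F \<xi> in at_infinity. dist (fourier_transform (s i) \<xi>) 0 < e / 2"
    using tendstoD[OF RL, of "e / 2"] \<open>e > 0\<close> by simp
  then show "\<forall>\<^sub>F \<xi> in at_infinity. dist (fourier_transform h \<xi>) 0 < e"
  proof eventually_elim
    case (elim \<xi>)
    have "norm (fourier_transform h \<xi>) \<le> norm (fourier_transform h \<xi> - fourier_transform (s i) \<xi>)
        + norm (fourier_transform (s i) \<xi>)"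
      using norm_triangle_ineq[of "fourier_transform h \<xi> - fourier_transform (s i) \<xi>" "fourier_transform (s i) \<xi>"] by simp
    then show ?case using close[of \<xi>] i elim by simp
  qed
qed

lemma fourier_transform_dominated_approx:
  fixes h :: "real \<Rightarrow> complex"
  assumes s: "\<And>i. integrable lebesgue (s i)"
    and RL: "\<And>i::nat. (fourier_transform (s i) \<longlongrightarrow> 0) at_infinity"
    and h: "integrable lebesgue h" and w: "integrable lebesgue w"
    and lim: "\<And>x. (\<lambda>i. s i x) \<longlonglongrightarrow> h x"
    and bound: "\<And>i x. norm (s i x) \<le> (w x :: real)"
  shows "(fourier_transform h \<longlongrightarrow> 0) at_infinity"
proof (rule fourier_transform_L1_approx[OF h s RL])
  have "(\<lambda>i. LINT x|lebesgue. norm (h x - s i x)) \<longlonglongrightarrow> (LINT x|lebesgue. norm (h x - h x))"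
  proof (rule integral_dominated_convergence[where w = "\<lambda>x. norm (h x) + w x"])
    show "integrable lebesgue (\<lambda>x. norm (h x) + w x)" using h w by simp
    show "AE x in lebesgue. (\<lambda>i. norm (h x - s i x)) \<longlonglongrightarrow> norm (h x - h x)"
      by (intro AE_I2 tendsto_intros lim)
    show "AE x in lebesgue. norm (norm (h x - s i x)) \<le> norm (h x) + w x" for i
      using bound norm_triangle_ineq4[of "h _" "s i _"] by (intro AE_I2) (smt (verit) norm_ge_zero real_norm_def)
  qed (use h s in auto)
  then show "(\<lambda>i. LINT x|lebesgue. norm (h x - s i x)) \<longlonglongrightarrow> 0" by simp
qed

lemma integral_cis_Icc_bound:
  assumes "a \<le> b" "c \<noteq> 0"
  shows "norm (integral {a..b} (\<lambda>x. cis (c * x))) \<le> 2 / \<bar>c\<bar>"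
proof -
  have "((\<lambda>x. cis (c * x)) has_integral (cis (c * b) / (\<i> * c) - cis (c * a) / (\<i> * c))) {a..b}"
  proof (rule fundamental_theorem_of_calculus[OF \<open>a \<le> b\<close>])
    fix x
    have "((\<lambda>z. exp (\<i> * of_real c * z) / (\<i> * of_real c)) has_field_derivative exp (\<i> * of_real c * of_real x)) (at (of_real x))"
      using \<open>c \<noteq> 0\<close> by (auto intro!: derivative_eq_intros)
    from has_vector_derivative_real_field[OF this, of "{a..b}"]
    show "((\<lambda>x. cis (c * x) / (\<i> * c)) has_vector_derivative cis (c * x)) (at x within {a..b})"
      by (simp add: cis_conv_exp mult.assoc)
  qed
  then have "norm (integral {a..b} (\<lambda>x. cis (c * x))) = norm (cis (c * b) / (\<i> * c) - cis (c * a) / (\<i> * c))"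
    by (simp add: integral_unique)
  also have "\<dots> \<le> norm (cis (c * b) / (\<i> * c)) + norm (cis (c * a) / (\<i> * c))"
    by (rule norm_triangle_ineq4)
  also have "\<dots> = 2 / \<bar>c\<bar>" by (simp add: norm_divide norm_mult)
  finally show ?thesis .
qed

lemma fourier_transform_indicator_Icc:
  "fourier_transform (indicator {a..b}) \<xi> = integral {a..b} (\<lambda>x. cis (- (2 * pi * \<xi>) * x))"
proof -
  have "(\<lambda>x. cis (- (2 * pi * \<xi>) * x)) absolutely_integrable_on {a..b}"
    by (rule absolutely_integrable_continuous_real) (intro continuous_intros)
  then have "integral {a..b} (\<lambda>x. cis (- (2 * pi * \<xi>) * x))
      = (LINT x|lebesgue. indicator {a..b} x *\<^sub>R cis (- (2 * pi * \<xi>) * x))"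
    by (simp add: set_lebesgue_integral_eq_integral(2)[symmetric] set_lebesgue_integral_def)
  moreover have "(\<lambda>x. indicator {a..b} x *\<^sub>R cis (- (2 * pi * \<xi>) * x))
      = (\<lambda>x. indicator {a..b} x * cis (- (2 * pi * x * \<xi>)))"
    by (auto simp: indicator_def fun_eq_iff mult_ac)
  ultimately show ?thesis by (simp add: fourier_transform_cis)
qed

lemma integrable_complex_indicator:
  assumes "A \<in> sets lebesgue" "emeasure lebesgue A < \<infinity>"
  shows "integrable lebesgue (indicator A :: real \<Rightarrow> complex)"
proof -
  have "integrable lebesgue (\<lambda>x. indicator A x *\<^sub>R (1 :: complex))"
    using integrable_real_indicator[OF assms] by (intro integrable_scaleR_left)
  moreover have "(\<lambda>x. indicator A x *\<^sub>R (1 :: complex)) = indicator A"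
    by (auto simp: indicator_def)
  ultimately show ?thesis by simp
qed

lemma integrable_complex_indicator_bounded:
  assumes "A \<in> sets borel"
  shows "integrable lebesgue (indicator (A \<inter> {-c..c::real}) :: real \<Rightarrow> complex)"
proof (rule integrable_complex_indicator)
  show "A \<inter> {- c..c} \<in> sets lebesgue" using assms by (intro sets_completionI_sets) auto
  have "emeasure lebesgue (A \<inter> {- c..c}) \<le> emeasure lebesgue {-c..c}"
    using assms by (intro emeasure_mono) auto
  also have "\<dots> < \<infinity>" by (cases "-c \<le> c") auto
  finally show "emeasure lebesgue (A \<inter> {- c..c}) < \<infinity>" .
qed

lemma riemann_lebesgue_Icc:
  "(fourier_transform (indicator {a..b}) \<longlongrightarrow> 0) at_infinity"
proof (cases "a \<le> b")
  case True
  show ?thesis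
  proof (rule Lim_null_comparison)
    show "\<forall>\<^sub>F \<xi> in at_infinity. norm (fourier_transform (indicator {a..b}) \<xi>) \<le> (1 / pi) * norm (inverse \<xi>)"
      unfolding eventually_at_infinity
    proof (intro exI[of _ 1] allI impI)
      fix \<xi> :: real assume "1 \<le> norm \<xi>"
      then show "norm (fourier_transform (indicator {a..b}) \<xi>) \<le> (1 / pi) * norm (inverse \<xi>)"
        using integral_cis_Icc_bound[OF True, of "- (2 * pi * \<xi>)"]
        unfolding fourier_transform_indicator_Icc by (simp add: field_simps abs_mult)
    qed
    have "((\<lambda>\<xi>::real. (1 / pi) * norm (inverse \<xi>)) \<longlongrightarrow> (1 / pi) * norm (0::real)) at_infinity"
      by (intro tendsto_mult tendsto_const tendsto_norm tendsto_inverse_0)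
    then show "((\<lambda>\<xi>. (1 / pi) * norm (inverse \<xi>)) \<longlongrightarrow> 0) (at_infinity :: real filter)" by simp
  qed
qed (simp add: fourier_transform_cis[abs_def])

text \<open>Intervals generate the Borel sets and are stable under intersection, and the claim is stable under
  complements (by linearity) and countable disjoint unions (by dominated convergence), so it passes from
  intervals to all Borel sets. Intersecting with a fixed bounded interval keeps every indicator integrable, also after
  taking complements.\<close>

lemma riemann_lebesgue_bounded_set:
  fixes c :: real
  assumes "A \<in> sets borel"
  shows "(fourier_transform (indicator (A \<inter> {-c..c})) \<longlongrightarrow> 0) at_infinity"
proof -
  define G where "G = range (\<lambda>(a, b). {a..b::real})"
  have gen: "sets borel = sigma_sets UNIV G"
    unfolding G_def borel_eq_atLeastAtMost[where 'a = real] 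
    by (simp add: sets_measure_of)
  have closed: "G \<subseteq> Pow UNIV" by simp
  have stable: "Int_stable G"
    by (auto simp: Int_stable_def G_def)
  have "A \<in> sigma_sets UNIV G" using assms gen by simp
  with stable closed show ?thesis
  proof (induction rule: sigma_sets_induct_disjoint)
    case (basic B)
    then obtain a b where "B = {a..b}" by (auto simp: G_def)
    then have "B \<inter> {-c..c} = {max a (-c)..min b c}" by auto
    then show ?case using riemann_lebesgue_Icc by metis
  next
    case empty
    then show ?case by (simp add: fourier_transform_cis[abs_def])
  next
    case (compl B)
    have B: "B \<in> sets borel" using compl.hyps gen by simp
    have "(indicator ((UNIV - B) \<inter> {-c..c}) :: real \<Rightarrow> complex)
        = (\<lambda>x. indicator {-c..c} x - indicator (B \<inter> {-c..c}) x)"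
      by (auto simp: indicator_def fun_eq_iff)
    then have "fourier_transform (indicator ((UNIV - B) \<inter> {-c..c}))
        = (\<lambda>\<xi>. fourier_transform (indicator {-c..c}) \<xi> - fourier_transform (indicator (B \<inter> {-c..c})) \<xi>)"
      using integrable_complex_indicator_bounded[OF B, of c] integrable_complex_indicator_bounded[of UNIV c]
      by (auto intro!: fourier_transform_diff)
    then show ?case
      using tendsto_diff[OF riemann_lebesgue_Icc[of "-c" c] compl.IH] by simp
  next
    case (union B)
    have B: "B i \<in> sets borel" for i using union.hyps gen by auto
    show ?case
    proof (rule fourier_transform_dominated_approx[where w = "indicator {-c..c}"])
      fix n :: nat
      show int: "integrable lebesgue (\<lambda>x. \<Sum>i<n. indicator (B i \<inter> {-c..c}) x :: complex)"
        by (intro Bochner_Integration.integrable_sum integrable_complex_indicator_bounded B)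
      show "(fourier_transform (\<lambda>x. \<Sum>i<n. indicator (B i \<inter> {-c..c}) x) \<longlongrightarrow> 0) at_infinity"
      proof (induction n)
        case 0
        then show ?case by (simp add: fourier_transform_cis[abs_def])
      next
        case (Suc n)
        have "fourier_transform (\<lambda>x. \<Sum>i<Suc n. indicator (B i \<inter> {-c..c}) x)
           = (\<lambda>\<xi>. fourier_transform (\<lambda>x. \<Sum>i<n. indicator (B i \<inter> {-c..c}) x) \<xi>
                + fourier_transform (indicator (B n \<inter> {-c..c})) \<xi>)"
          by (auto intro!: fourier_transform_add Bochner_Integration.integrable_sum
              integrable_complex_indicator_bounded B)
        then show ?case using tendsto_add[OF Suc.IH union.IH[of n]] by simp
      qed
      fix x :: real
      have partial: "(\<Sum>i<n. indicator (B i \<inter> {-c..c}) x :: complex) = indicator ((\<Union>i<n. B i) \<inter> {-c..c}) x" for n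
      proof -
        have "disjoint_family_on (\<lambda>i. B i \<inter> {-c..c}) {..<n}"
          using union.hyps by (auto simp: disjoint_family_on_def)
        then have "indicator (\<Union>i<n. B i \<inter> {-c..c}) x = (\<Sum>i<n. indicator (B i \<inter> {-c..c}) x :: complex)"
          by (intro indicator_UN_disjoint) auto
        then show ?thesis by simp
      qed
      show "norm (\<Sum>i<n. indicator (B i \<inter> {-c..c}) x :: complex) \<le> indicator {-c..c} x"
        unfolding partial by (auto simp: indicator_def)
      show "(\<lambda>n. \<Sum>i<n. indicator (B i \<inter> {-c..c}) x :: complex) \<longlonglongrightarrow> indicator (\<Union> (range B) \<inter> {-c..c}) x"
      proof -
        have "(\<lambda>n. indicator ((\<Union>i<n. B i) \<inter> {-c..c}) x :: complex) \<longlonglongrightarrow> indicator (\<Union> (range B) \<inter> {-c..c}) x"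
        proof (rule tendsto_eventually)
          show "\<forall>\<^sub>F n in sequentially. (indicator ((\<Union>i<n. B i) \<inter> {-c..c}) x :: complex) = indicator (\<Union> (range B) \<inter> {-c..c}) x"
          proof (cases "\<exists>j. x \<in> B j")
            case True
            then obtain j where "x \<in> B j" by blast
            then show ?thesis
              unfolding eventually_sequentially by (intro exI[of _ "Suc j"]) (auto simp: indicator_def)
          qed (auto simp: indicator_def)
        qed
        then show ?thesis unfolding partial .
      qed
    next
      show "integrable lebesgue (indicator {-c..c} :: real \<Rightarrow> real)"
        by (rule integrable_real_indicator) (cases "-c \<le> c"; simp)+
      show "integrable lebesgue (indicator (\<Union> (range B) \<inter> {-c..c}) :: real \<Rightarrow> complex)"
        by (rule integrable_complex_indicator_bounded) (use B in auto)
    qed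
  qed
qed

text \<open>Integrable functions are dominated limits of simple functions, and a set of finite measure is
  the limit of its bounded parts; this reduces the claim to indicators of bounded Borel sets.\<close>

lemma riemann_lebesgue_lborel:
  fixes h :: "real \<Rightarrow> complex"
  assumes "integrable lborel h"
  shows "(fourier_transform h \<longlongrightarrow> 0) at_infinity"
  using assms
proof (induction rule: integrable_induct)
  case (base A c)
  have A: "A \<in> sets lebesgue" "emeasure lebesgue A < \<infinity>" using base by auto
  have "(fourier_transform (indicator A) \<longlongrightarrow> 0) at_infinity"
  proof (rule fourier_transform_dominated_approx[where s = "\<lambda>n. indicator (A \<inter> {-real n..real n})" and w = "indicator A"])
    show "(\<lambda>n. indicator (A \<inter> {-real n..real n}) x :: complex) \<longlonglongrightarrow> indicator A x" for x
    proof (rule tendsto_eventually)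
      obtain m where m: "\<bar>x\<bar> \<le> real m" using real_arch_simple by blast
      show "\<forall>\<^sub>F n in sequentially. (indicator (A \<inter> {-real n..real n}) x :: complex) = indicator A x"
        unfolding eventually_sequentially
        using m by (intro exI[of _ m]) (auto simp: indicator_def)
    qed
  qed (use base A in \<open>auto intro!: integrable_complex_indicator_bounded riemann_lebesgue_bounded_set
         integrable_complex_indicator integrable_real_indicator simp: indicator_def\<close>)
  then have "((\<lambda>\<xi>. c * fourier_transform (indicator A) \<xi>) \<longlongrightarrow> c * 0) at_infinity"
    by (rule tendsto_mult_left)
  moreover have "(\<lambda>x. indicator A x *\<^sub>R c) = (\<lambda>x. c * indicator A x)"
    by (auto simp: indicator_def)
  ultimately show ?case by (simp add: fourier_transform_cmult[abs_def])
next
  case (add f g)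
  then have "fourier_transform (\<lambda>x. f x + g x) = (\<lambda>\<xi>. fourier_transform f \<xi> + fourier_transform g \<xi>)"
    by (auto intro!: fourier_transform_add simp: integrable_completion)
  then show ?case using tendsto_add[OF add.IH] by simp
next
  case (lim f s)
  show ?case
    by (rule fourier_transform_dominated_approx[where s = s and w = "\<lambda>x. 2 * norm (f x)"])
       (use lim in \<open>auto simp: integrable_completion\<close>)
qed

theorem riemann_lebesgue:
  assumes h: "integrable lebesgue h"
  shows "(fourier_transform h \<longlongrightarrow> 0) at_infinity"
proof -
  obtain h' where h': "integrable lborel h'" "AE x in lebesgue. h x = h' x"
    using borel_representative[OF h] .
  have "fourier_transform h = fourier_transform h'"
    using fourier_transform_borel_representative[OF h h']
      fourier_transform_borel_representative[OF _ h'(1)] h'(1)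
    by (auto simp: integrable_completion)
  then show ?thesis using riemann_lebesgue_lborel[OF h'(1)] by simp
qed

section \<open>Dirichlet integrals of functions of bounded variation\<close>

text \<open>The Jordan decomposition: the total variation \<open>P x\<close> of \<open>h\<close> on \<open>{a..x}\<close> grows
  from \<open>x\<close> to \<open>y\<close> by at least \<open>|h y - h x|\<close>, hence both \<open>P\<close> and \<open>P - h\<close> are monotone.\<close>

lemma bounded_variation_on_imp_mono_diff:
  fixes h :: "real \<Rightarrow> real"
  assumes bv: "bounded_variation_on h {a..b}"
  obtains p q where "mono_on {a..b} p" "mono_on {a..b} q" "\<And>x. h x = p x - q x"
proof -
  define var where "var m t = (\<Sum>i<m. \<bar>h (t (Suc i)) - h (t i)\<bar>)" for m :: nat and t :: "nat \<Rightarrow> real"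
  define V where "V x = {var m t | m t. mono_on {..m} t \<and> t ` {..m} \<subseteq> {a..x}}" for x
  define P where "P x = Sup (V x)" for x
  obtain B where B: "\<And>m t. mono_on {..m} t \<Longrightarrow> t ` {..m} \<subseteq> {a..b} \<Longrightarrow> var m t \<le> B"
    using bv unfolding bounded_variation_on_def var_def by auto
  have bdd: "bdd_above (V x)" if "x \<le> b" for x
    using B that unfolding V_def by (intro bdd_aboveI[of _ B]) force
  have ne: "V x \<noteq> {}" if "a \<le> x" for x
  proof -
    have "var 0 (\<lambda>_. a) \<in> V x"
      using that unfolding V_def by (auto intro!: exI[of _ 0] exI[of _ "\<lambda>_. a"] simp: mono_on_def)
    then show ?thesis by blast
  qed
  have step: "P x + \<bar>h y - h x\<bar> \<le> P y" if "a \<le> x" "x \<le> y" "y \<le> b" for x y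
  proof -
    have "v \<le> P y - \<bar>h y - h x\<bar>" if "v \<in> V x" for v
    proof -
      from that obtain m t where t: "mono_on {..m} t" "t ` {..m} \<subseteq> {a..x}" and v: "v = var m t"
        unfolding V_def by blast
      \<comment> \<open>Prolonging a partition of \<open>{a..x}\<close> by \<open>x\<close> and \<open>y\<close> adds at least \<open>|h y - h x|\<close> to its variation sum\<close>
      define s where "s i = (if i \<le> m then t i else if i = Suc m then x else y)" for i
      have tx: "a \<le> t i" "t i \<le> x" if "i \<le> m" for i using t(2) that by auto
      have "mono_on {..Suc (Suc m)} s"
      proof (rule mono_onI)
        fix i j :: nat assume "i \<le> j"
        then consider "j \<le> m" | "i \<le> m" "m < j" | "m < i" by linarith
        then show "s i \<le> s j"
        proof cases
          case 1
          then show ?thesis using monotone_onD[OF t(1), of i j] \<open>i \<le> j\<close> by (simp add: s_def)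
        next
          case 2
          then show ?thesis using tx(2)[of i] \<open>x \<le> y\<close> by (simp add: s_def)
        next
          case 3
          then show ?thesis using \<open>i \<le> j\<close> \<open>x \<le> y\<close> by (simp add: s_def)
        qed
      qed
      moreover have "s ` {..Suc (Suc m)} \<subseteq> {a..y}"
      proof (rule image_subsetI)
        fix i
        show "s i \<in> {a..y}"
          using tx[of i] \<open>a \<le> x\<close> \<open>x \<le> y\<close> by (auto simp: s_def intro: order_trans[of _ x])
      qed
      ultimately have "var (Suc (Suc m)) s \<le> P y"
        unfolding P_def by (intro cSup_upper bdd \<open>y \<le> b\<close>) (auto simp: V_def)
      moreover have "var (Suc (Suc m)) s = v + \<bar>h x - h (t m)\<bar> + \<bar>h y - h x\<bar>"
        unfolding var_def v by (simp add: s_def)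
      ultimately show ?thesis by linarith
    qed
    then have "P x \<le> P y - \<bar>h y - h x\<bar>"
      unfolding P_def using ne[OF \<open>a \<le> x\<close>] by (intro cSup_least)
    then show ?thesis by linarith
  qed
  show thesis
  proof
    show "mono_on {a..b} P"
    proof (rule mono_onI)
      fix x y assume "x \<in> {a..b}" "y \<in> {a..b}" "x \<le> y"
      then show "P x \<le> P y" using step[of x y] by auto
    qed
    show "mono_on {a..b} (\<lambda>x. P x - h x)"
    proof (rule mono_onI)
      fix x y assume "x \<in> {a..b}" "y \<in> {a..b}" "x \<le> y"
      then show "P x - h x \<le> P y - h y" using step[of x y] by auto
    qed
    show "h x = P x - (P x - h x)" for x by simp
  qed
qed

lemma mono_on_right_limit:
  fixes p :: "real \<Rightarrow> real"
  assumes p: "mono_on {a..b} p" and "a < b"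
  obtains L where "(p \<longlongrightarrow> L) (at_right a)" "\<And>x. a < x \<Longrightarrow> x \<le> b \<Longrightarrow> L \<le> p x"
proof
  define L where "L = Inf (p ` {a<..b})"
  have bdd: "bdd_below (p ` {a<..b})"
    using p by (intro bdd_belowI[of _ "p a"]) (auto simp: mono_on_def)
  show L: "L \<le> p x" if "a < x" "x \<le> b" for x
    unfolding L_def using bdd that by (intro cInf_lower) auto
  show "(p \<longlongrightarrow> L) (at_right a)"
  proof (rule order_tendstoI)
    fix c assume "c < L"
    then show "\<forall>\<^sub>F x in at_right a. c < p x"
      unfolding eventually_at_right_field using L \<open>a < b\<close> by (intro exI[of _ b]) force
  next
    fix c assume "L < c"
    then obtain z where z: "a < z" "z \<le> b" "p z < c"
      using cInf_lessD[of "p ` {a<..b}" c] \<open>a < b\<close> unfolding L_def by auto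
    have "p x < c" if "a < x" "x < z" for x
      using monotone_onD[OF p, of x z] that z by auto
    then show "\<forall>\<^sub>F x in at_right a. p x < c"
      unfolding eventually_at_right_field using z by blast
  qed
qed

lemma has_integral_sine_kernel:
  assumes "a \<le> b" "l \<noteq> 0"
  shows "((\<lambda>u. sin (l * u) / u) has_integral (Si (l * b) - Si (l * a))) {a..b}"
proof -
  have "((\<lambda>u. l * sinc (l * u)) has_integral (Si (l * b) - Si (l * a))) {a..b}"
  proof (rule fundamental_theorem_of_calculus[OF \<open>a \<le> b\<close>])
    fix x
    have "((\<lambda>u. Si (l * u)) has_real_derivative sinc (l * x) * l) (at x)"
      by (rule DERIV_chain2[OF DERIV_Si]) (auto intro!: derivative_eq_intros)
    then show "((\<lambda>u. Si (l * u)) has_vector_derivative l * sinc (l * x)) (at x within {a..b})"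
      by (simp add: has_real_derivative_iff_has_vector_derivative has_vector_derivative_at_within mult.commute)
  qed
  from this show ?thesis
    by (rule has_integral_spike[where S = "{0}" and f = "\<lambda>u. l * sinc (l * u)", rotated 2]) (use \<open>l \<noteq> 0\<close> in auto)
qed

text \<open>Subtracting the limit, whose contribution is \<open>L Si(ld)\<close>, leaves a monotone function \<open>q\<close> that starts at
  zero. On \<open>{0..\<eta>}\<close> the second mean value theorem bounds its integral against the kernel by
  \<open>q \<eta>\<close> times the oscillation of \<open>Si\<close>, uniformly in \<open>l\<close>; on \<open>{\<eta>..d}\<close> the same theorem leaves only
  differences of \<open>Si\<close> at points beyond \<open>l \<eta>\<close>, which tend to zero.\<close>

lemma mono_dirichlet_one_sided:
  fixes p :: "real \<Rightarrow> real"
  assumes p: "mono_on {0..d} p" and "0 < d" and lim: "(p \<longlongrightarrow> L) (at_right 0)"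
    and pL: "\<And>x. 0 < x \<Longrightarrow> x \<le> d \<Longrightarrow> L \<le> p x"
  obtains J where "\<And>l. 0 < l \<Longrightarrow> ((\<lambda>u. p u * (sin (l * u) / u)) has_integral J l) {0..d}"
    and "(J \<longlongrightarrow> pi / 2 * L) at_top"
proof -
  obtain M where M: "\<And>T. \<bar>Si T\<bar> \<le> M" using bounded_Si by blast
  define k where "k l u = sin (l * u) / u" for l u :: real
  have k: "(k l has_integral (Si (l * y) - Si (l * x))) {x..y}" if "0 < l" "x \<le> y" for l x y
    using has_integral_sine_kernel[of x y l] that by (simp add: k_def[abs_def])
  then have ki: "k l integrable_on {x..y}" "integral {x..y} (k l) = Si (l * y) - Si (l * x)"
    if "0 < l" "x \<le> y" for l x y using that by (auto simp: has_integral_iff)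
  define q where "q u = (if u = 0 then 0 else p u - L)" for u
  have q_mono: "q x \<le> q y" if "0 \<le> x" "x \<le> y" "y \<le> d" for x y
    using pL monotone_onD[OF p, of x y] that by (auto simp: q_def)
  have q_nonneg: "0 \<le> q x" if "0 \<le> x" "x \<le> d" for x using pL that by (auto simp: q_def)
  have near: "\<exists>I. ((\<lambda>u. q u * k l u) has_integral I) {0..\<eta>} \<and> \<bar>I\<bar> \<le> 2 * M * q \<eta>"
    if A: "0 < l" "0 < \<eta>" "\<eta> \<le> d" for l \<eta>
  proof -
    obtain c where c: "c \<in> {0..\<eta>}" and I: "((\<lambda>u. q u * k l u) has_integral
        (q 0 * integral {0..c} (k l) + q \<eta> * integral {c..\<eta>} (k l))) {0..\<eta>}"
      by (rule second_mean_value_theorem_full[OF ki(1), of l 0 \<eta> q]) (use q_mono A in auto)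
    have "\<bar>Si (l * \<eta>) - Si (l * c)\<bar> \<le> 2 * M" using M[of "l * \<eta>"] M[of "l * c"] by linarith
    then have "\<bar>q \<eta> * (Si (l * \<eta>) - Si (l * c))\<bar> \<le> 2 * M * q \<eta>"
      using q_nonneg[of \<eta>] that by (simp add: abs_mult mult.commute mult_left_mono)
    moreover have "q 0 * integral {0..c} (k l) + q \<eta> * integral {c..\<eta>} (k l) = q \<eta> * (Si (l * \<eta>) - Si (l * c))"
      using ki(2)[OF A(1), of c \<eta>] c by (simp add: q_def)
    ultimately show ?thesis using I by metis
  qed
  have far: "\<exists>I. ((\<lambda>u. q u * k l u) has_integral I) {\<eta>..d} \<and> \<bar>I\<bar> \<le> 4 * e * q d"
    if A: "0 < l" "0 < \<eta>" "\<eta> \<le> d" and e: "\<And>T. l * \<eta> \<le> T \<Longrightarrow> \<bar>Si T - pi / 2\<bar> \<le> e" for l \<eta> e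
  proof -
    obtain c where c: "c \<in> {\<eta>..d}" and I: "((\<lambda>u. q u * k l u) has_integral
        (q \<eta> * integral {\<eta>..c} (k l) + q d * integral {c..d} (k l))) {\<eta>..d}"
      by (rule second_mean_value_theorem_full[OF ki(1), of l \<eta> d q]) (use q_mono A in auto)
    have e': "\<bar>Si (l * \<eta>) - pi / 2\<bar> \<le> e" "\<bar>Si (l * c) - pi / 2\<bar> \<le> e" "\<bar>Si (l * d) - pi / 2\<bar> \<le> e"
      using e[of "l * \<eta>"] e[of "l * c"] e[of "l * d"] c \<open>0 < l\<close> \<open>\<eta> \<le> d\<close> by simp_all
    then have "\<bar>Si (l * c) - Si (l * \<eta>)\<bar> \<le> 2 * e" "\<bar>Si (l * d) - Si (l * c)\<bar> \<le> 2 * e" "0 \<le> e"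
      by linarith+
    note e'' = this
    have "\<bar>q \<eta> * (Si (l * c) - Si (l * \<eta>))\<bar> \<le> q d * (2 * e)"
      using e'' q_nonneg[of \<eta>] q_mono[of \<eta> d] A unfolding abs_mult by (intro mult_mono) auto
    moreover have "\<bar>q d * (Si (l * d) - Si (l * c))\<bar> \<le> q d * (2 * e)"
      using e'' q_nonneg[of d] A unfolding abs_mult by (intro mult_mono) auto
    moreover have "4 * e * q d = q d * (2 * e) + q d * (2 * e)" by simp
    ultimately have "\<bar>q \<eta> * (Si (l * c) - Si (l * \<eta>)) + q d * (Si (l * d) - Si (l * c))\<bar> \<le> 4 * e * q d"
      by linarith
    moreover have "integral {\<eta>..c} (k l) = Si (l * c) - Si (l * \<eta>)" "integral {c..d} (k l) = Si (l * d) - Si (l * c)"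
      using ki(2)[OF A(1)] c by auto
    ultimately show ?thesis using I by metis
  qed
  define J where "J l = integral {0..d} (\<lambda>u. p u * k l u)" for l
  have split: "((\<lambda>u. p u * k l u) has_integral (I + L * Si (l * d))) {0..d}"
    if "0 < l" "((\<lambda>u. q u * k l u) has_integral I) {0..d}" for l I
  proof -
    have Si0: "Si 0 = 0" by (simp add: Si_def zero_ereal_def)
    have "((\<lambda>u. q u * k l u + L * k l u) has_integral (I + L * (Si (l * d) - Si (l * 0)))) {0..d}"
      using that \<open>0 < d\<close> by (intro has_integral_add has_integral_mult_right k) auto
    moreover have "q u * k l u + L * k l u = p u * k l u" for u
      unfolding q_def k_def by (cases "u = 0") (simp_all flip: distrib_right add_divide_distrib)
    ultimately show ?thesis by (simp add: Si0)
  qed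
  have J: "((\<lambda>u. p u * k l u) has_integral J l) {0..d}" if "0 < l" for l
    using near[OF that \<open>0 < d\<close> order_refl] split[OF that] unfolding J_def
    by (blast intro: has_integral_integral[THEN iffD1] has_integral_integrable)
  show thesis
  proof
    show "((\<lambda>u. p u * (sin (l * u) / u)) has_integral J l) {0..d}" if "0 < l" for l
      using J[OF that] by (simp add: k_def)
    show "(J \<longlongrightarrow> pi / 2 * L) at_top"
    proof (rule tendstoI)
      fix e :: real assume "0 < e"
      have "((\<lambda>x. 2 * M * (p x - L)) \<longlongrightarrow> 2 * M * (L - L)) (at_right 0)"
        by (intro tendsto_intros lim)
      then have "\<forall>\<^sub>F x in at_right 0. 2 * M * (p x - L) < e / 2"
        by (rule order_tendstoD(2)) (use \<open>0 < e\<close> in simp)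
      then obtain z where z: "0 < z" "\<And>x. 0 < x \<Longrightarrow> x < z \<Longrightarrow> 2 * M * (p x - L) < e / 2"
        unfolding eventually_at_right_field by auto
      define \<eta> where "\<eta> = min (z / 2) d"
      have \<eta>: "0 < \<eta>" "\<eta> \<le> d" "2 * M * q \<eta> < e / 2"
        using z \<open>0 < d\<close> by (auto simp: \<eta>_def q_def)
      define K where "K = 4 * q d + \<bar>L\<bar> + 1"
      have K: "0 < K" using q_nonneg[of d] \<open>0 < d\<close> by (simp add: K_def)
      define e1 where "e1 = e / (2 * K)"
      have e1: "0 < e1" "K * e1 = e / 2" using K \<open>0 < e\<close> by (auto simp: e1_def)
      have "\<forall>\<^sub>F T in at_top. dist (Si T) (pi / 2) < e1" by (rule tendstoD[OF Si_at_top e1(1)])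
      then obtain T0 where T0: "\<And>T. T0 \<le> T \<Longrightarrow> \<bar>Si T - pi / 2\<bar> < e1"
        unfolding eventually_at_top_linorder dist_real_def by blast
      show "\<forall>\<^sub>F l in at_top. dist (J l) (pi / 2 * L) < e"
        using eventually_ge_at_top[of "max 1 (T0 / \<eta>)"]
      proof eventually_elim
        case (elim l)
        then have l: "0 < l" "T0 \<le> l * \<eta>" using \<eta> by (auto simp: field_simps)
        have small: "\<bar>Si T - pi / 2\<bar> \<le> e1" if "l * \<eta> \<le> T" for T
          using T0[of T] l that by simp
        obtain I1 where I1: "((\<lambda>u. q u * k l u) has_integral I1) {0..\<eta>}" "\<bar>I1\<bar> \<le> 2 * M * q \<eta>"
          using near[OF l(1) \<eta>(1,2)] by blast
        obtain I2 where I2: "((\<lambda>u. q u * k l u) has_integral I2) {\<eta>..d}" "\<bar>I2\<bar> \<le> 4 * e1 * q d"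
          using far[OF l(1) \<eta>(1,2) small] by blast
        have "((\<lambda>u. q u * k l u) has_integral (I1 + I2)) {0..d}"
          using \<eta> by (intro has_integral_combine[OF _ _ I1(1) I2(1)]) auto
        then have "J l = I1 + I2 + L * Si (l * d)"
          using split[OF l(1)] J[OF l(1)] has_integral_unique by blast
        then have "\<bar>J l - pi / 2 * L\<bar> = \<bar>I1 + I2 + L * (Si (l * d) - pi / 2)\<bar>"
          by (simp add: algebra_simps)
        also have "\<dots> \<le> \<bar>I1\<bar> + \<bar>I2\<bar> + \<bar>L\<bar> * \<bar>Si (l * d) - pi / 2\<bar>"
          by (simp add: abs_mult[symmetric])
        also have "\<dots> \<le> 2 * M * q \<eta> + 4 * e1 * q d + \<bar>L\<bar> * e1"
          using I1(2) I2(2) small[of "l * d"] \<eta> l by (intro add_mono mult_left_mono) auto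
        also have "\<dots> \<le> 2 * M * q \<eta> + K * e1"
          using e1 by (simp add: K_def algebra_simps)
        also have "\<dots> < e" using \<eta>(3) e1(2) by simp
        finally show ?case by (simp add: dist_real_def)
      qed
    qed
  qed
qed

text \<open>The predicate bundles the one-sided limits at zero with the Dirichlet integral they determine, so that the
  statement for monotone functions can be carried through sums and linear maps to complex functions of bounded
  variation.\<close>

definition has_dirichlet_limits :: "(real \<Rightarrow> 'a::real_normed_vector) \<Rightarrow> real \<Rightarrow> 'a \<Rightarrow> 'a \<Rightarrow> bool" where
  "has_dirichlet_limits p d L R \<longleftrightarrow>
     (p \<longlongrightarrow> L) (at_left 0) \<and> (p \<longlongrightarrow> R) (at_right 0) \<and>
     (\<exists>J. (\<forall>l>0. ((\<lambda>u. (sin (l * u) / u) *\<^sub>R p u) has_integral J l) {-d..d}) \<and>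
          (J \<longlongrightarrow> (pi / 2) *\<^sub>R (L + R)) at_top)"

text \<open>The kernel is even, so the left half is the right half for the reflected function \<open>- p (- u)\<close>, which is again
  monotone.\<close>

lemma has_dirichlet_limits_mono:
  fixes p :: "real \<Rightarrow> real"
  assumes p: "mono_on {-d..d} p" and "0 < d"
  shows "\<exists>L R. has_dirichlet_limits p d L R"
proof -
  define p' where "p' u = - p (- u)" for u
  have p_right: "mono_on {0..d} p" using p \<open>0 < d\<close> by (auto simp: mono_on_def)
  have p_left: "mono_on {0..d} p'" using p \<open>0 < d\<close> by (auto simp: mono_on_def p'_def)
  obtain R where R: "(p \<longlongrightarrow> R) (at_right 0)" "\<And>x. 0 < x \<Longrightarrow> x \<le> d \<Longrightarrow> R \<le> p x"
    using mono_on_right_limit[OF p_right \<open>0 < d\<close>] by blast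
  obtain L where L: "(p' \<longlongrightarrow> L) (at_right 0)" "\<And>x. 0 < x \<Longrightarrow> x \<le> d \<Longrightarrow> L \<le> p' x"
    using mono_on_right_limit[OF p_left \<open>0 < d\<close>] by blast
  obtain J where J: "\<And>l. 0 < l \<Longrightarrow> ((\<lambda>u. p u * (sin (l * u) / u)) has_integral J l) {0..d}"
    "(J \<longlongrightarrow> pi / 2 * R) at_top"
    using mono_dirichlet_one_sided[OF p_right \<open>0 < d\<close> R] by blast
  obtain J' where J': "\<And>l. 0 < l \<Longrightarrow> ((\<lambda>u. p' u * (sin (l * u) / u)) has_integral J' l) {0..d}"
    "(J' \<longlongrightarrow> pi / 2 * L) at_top"
    using mono_dirichlet_one_sided[OF p_left \<open>0 < d\<close> L] by blast
  have "(p \<longlongrightarrow> - L) (at_left 0)"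
    using tendsto_minus[OF L(1)] by (simp add: filterlim_at_left_to_right p'_def)
  moreover have "((\<lambda>u. (sin (l * u) / u) *\<^sub>R p u) has_integral (- J' l + J l)) {-d..d}" if "0 < l" for l
  proof (rule has_integral_combine[of _ 0])
    have "((\<lambda>u. p' (- u) * (sin (l * - u) / - u)) has_integral J' l) {-d..- 0}"
      by (rule has_integral_reflect_lemma_real) (rule J'(1)[OF that])
    from has_integral_neg[OF this]
    show "((\<lambda>u. (sin (l * u) / u) *\<^sub>R p u) has_integral - J' l) {-d..0}"
      by (simp add: p'_def mult.commute)
    show "((\<lambda>u. (sin (l * u) / u) *\<^sub>R p u) has_integral J l) {0..d}"
      using J(1)[OF that] by (simp add: mult.commute)
  qed (use \<open>0 < d\<close> in auto)
  moreover have "((\<lambda>l. - J' l + J l) \<longlongrightarrow> (pi / 2) *\<^sub>R (- L + R)) at_top"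
    using tendsto_add[OF tendsto_minus[OF J'(2)] J(2)] by (simp add: algebra_simps diff_divide_distrib)
  ultimately have "has_dirichlet_limits p d (- L) R"
    unfolding has_dirichlet_limits_def using R(1) by (intro conjI exI[of _ "\<lambda>l. - J' l + J l"]) auto
  then show ?thesis by blast
qed

lemma has_dirichlet_limits_add:
  assumes "has_dirichlet_limits p d L R" "has_dirichlet_limits q d L' R'"
  shows "has_dirichlet_limits (\<lambda>u. p u + q u) d (L + L') (R + R')"
proof -
  obtain J J' where J: "\<And>l. 0 < l \<Longrightarrow> ((\<lambda>u. (sin (l * u) / u) *\<^sub>R p u) has_integral J l) {-d..d}"
    "(J \<longlongrightarrow> (pi / 2) *\<^sub>R (L + R)) at_top"
    and J': "\<And>l. 0 < l \<Longrightarrow> ((\<lambda>u. (sin (l * u) / u) *\<^sub>R q u) has_integral J' l) {-d..d}"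
    "(J' \<longlongrightarrow> (pi / 2) *\<^sub>R (L' + R')) at_top"
    using assms unfolding has_dirichlet_limits_def by blast
  show ?thesis
    unfolding has_dirichlet_limits_def
  proof (intro conjI exI[of _ "\<lambda>l. J l + J' l"] allI impI)
    show "((\<lambda>u. (sin (l * u) / u) *\<^sub>R (p u + q u)) has_integral (J l + J' l)) {-d..d}" if "0 < l" for l
      using has_integral_add[OF J(1) J'(1), OF that that] by (simp add: scaleR_add_right)
    show "((\<lambda>l. J l + J' l) \<longlongrightarrow> (pi / 2) *\<^sub>R (L + L' + (R + R'))) at_top"
      using tendsto_add[OF J(2) J'(2)] by (simp add: algebra_simps)
  qed (use assms in \<open>auto simp: has_dirichlet_limits_def intro!: tendsto_add\<close>)
qed

lemma has_dirichlet_limits_linear: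
  assumes p: "has_dirichlet_limits p d L R" and f: "bounded_linear f"
  shows "has_dirichlet_limits (\<lambda>u. f (p u)) d (f L) (f R)"
proof -
  interpret f: bounded_linear f by fact
  obtain J where J: "\<And>l. 0 < l \<Longrightarrow> ((\<lambda>u. (sin (l * u) / u) *\<^sub>R p u) has_integral J l) {-d..d}"
    "(J \<longlongrightarrow> (pi / 2) *\<^sub>R (L + R)) at_top"
    using p unfolding has_dirichlet_limits_def by blast
  show ?thesis
    unfolding has_dirichlet_limits_def
  proof (intro conjI exI[of _ "\<lambda>l. f (J l)"] allI impI)
    show "((\<lambda>u. (sin (l * u) / u) *\<^sub>R f (p u)) has_integral f (J l)) {-d..d}" if "0 < l" for l
      using has_integral_linear[OF J(1)[OF that] f] by (simp add: o_def f.scaleR)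
    show "((\<lambda>l. f (J l)) \<longlongrightarrow> (pi / 2) *\<^sub>R (f L + f R)) at_top"
      using f.tendsto[OF J(2)] by (simp add: f.scaleR f.add)
  qed (use p in \<open>auto simp: has_dirichlet_limits_def intro!: f.tendsto\<close>)
qed

lemma has_dirichlet_limits_bounded_variation_real:
  fixes h :: "real \<Rightarrow> real"
  assumes "bounded_variation_on h {-d..d}" "0 < d"
  shows "\<exists>L R. has_dirichlet_limits h d L R"
proof -
  obtain p q where pq: "mono_on {-d..d} p" "mono_on {-d..d} q" "\<And>x. h x = p x - q x"
    using bounded_variation_on_imp_mono_diff[OF assms(1)] by metis
  obtain L R L' R' where "has_dirichlet_limits p d L R" "has_dirichlet_limits q d L' R'"
    using has_dirichlet_limits_mono[OF pq(1) assms(2)] has_dirichlet_limits_mono[OF pq(2) assms(2)] by blast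
  from has_dirichlet_limits_add[OF this(1) has_dirichlet_limits_linear[OF this(2) bounded_linear_minus[OF bounded_linear_ident]]]
  have "has_dirichlet_limits (\<lambda>u. p u + - q u) d (L + - L') (R + - R')" .
  moreover have "h = (\<lambda>u. p u + - q u)" using pq(3) by auto
  ultimately show ?thesis by auto
qed

lemma bounded_variation_on_contraction:
  assumes bv: "bounded_variation_on g S" and f: "\<And>x y. norm (f (g x) - f (g y)) \<le> norm (g x - g y)"
  shows "bounded_variation_on (\<lambda>x. f (g x)) S"
proof -
  obtain B where B: "\<And>m t. mono_on {..m} t \<Longrightarrow> t ` {..m} \<subseteq> S \<Longrightarrow>
      (\<Sum>i<m::nat. norm (g (t (Suc i)) - g (t i))) \<le> B"
    using bv unfolding bounded_variation_on_def by blast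
  show ?thesis
    unfolding bounded_variation_on_def
    by (intro exI[of _ B] allI impI order_trans[OF sum_mono[OF f] B]) auto
qed

lemma bounded_variation_on_translate:
  fixes g :: "real \<Rightarrow> 'a::real_normed_vector"
  assumes bv: "bounded_variation_on g {a - d..a + d}"
  shows "bounded_variation_on (\<lambda>u. g (u + a)) {-d..d}"
proof -
  obtain B where B: "\<And>m t. mono_on {..m} t \<Longrightarrow> t ` {..m} \<subseteq> {a - d..a + d} \<Longrightarrow>
      (\<Sum>i<m::nat. norm (g (t (Suc i)) - g (t i))) \<le> B"
    using bv unfolding bounded_variation_on_def by blast
  have "(\<Sum>i<m. norm (g (t (Suc i) + a) - g (t i + a))) \<le> B"
    if "mono_on {..m} t" "t ` {..m} \<subseteq> {-d..d}" for m :: nat and t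
  proof (rule B[of m "\<lambda>i. t i + a"])
    show "mono_on {..m} (\<lambda>i. t i + a)" using that(1) by (simp add: mono_on_def)
    show "(\<lambda>i. t i + a) ` {..m} \<subseteq> {a - d..a + d}" using that(2) by force
  qed
  then show ?thesis unfolding bounded_variation_on_def by blast
qed

lemma bounded_variation_on_subset:
  "bounded_variation_on g S \<Longrightarrow> T \<subseteq> S \<Longrightarrow> bounded_variation_on g T"
  unfolding bounded_variation_on_def by (meson order_trans)

text \<open>The real and imaginary parts of \<open>g\<close> are differences of monotone functions, so the one-sided limits exist and
  the monotone case adds up.\<close>

theorem dirichlet_jordan:
  fixes g :: "real \<Rightarrow> complex"
  assumes bv: "bounded_variation_on g {a - d..a + d}" and "0 < d"
  shows "((\<lambda>l. integral {a - d..a + d} (\<lambda>y. (sin (l * (y - a)) / (y - a)) *\<^sub>R g y))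
           \<longlongrightarrow> (pi / 2) *\<^sub>R (left_lim g a + right_lim g a)) at_top"
proof -
  define G where "G u = g (u + a)" for u
  have G: "bounded_variation_on G {-d..d}"
    using bounded_variation_on_translate[OF bv] by (simp add: G_def[abs_def])
  have "\<bar>Re (G x) - Re (G y)\<bar> \<le> norm (G x - G y)" "\<bar>Im (G x) - Im (G y)\<bar> \<le> norm (G x - G y)" for x y
    using abs_Re_le_cmod[of "G x - G y"] abs_Im_le_cmod[of "G x - G y"] by auto
  then have re: "bounded_variation_on (\<lambda>u. Re (G u)) {-d..d}" and im: "bounded_variation_on (\<lambda>u. Im (G u)) {-d..d}"
    using bounded_variation_on_contraction[OF G, of Re] bounded_variation_on_contraction[OF G, of Im] by simp_all
  obtain L R where LR: "has_dirichlet_limits (\<lambda>u. Re (G u)) d L R"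
    using has_dirichlet_limits_bounded_variation_real[OF re \<open>0 < d\<close>] by blast
  obtain L' R' where LR': "has_dirichlet_limits (\<lambda>u. Im (G u)) d L' R'"
    using has_dirichlet_limits_bounded_variation_real[OF im \<open>0 < d\<close>] by blast
  note LR[THEN has_dirichlet_limits_linear, OF bounded_linear_of_real]
    LR'[THEN has_dirichlet_limits_linear, OF bounded_linear_of_real, THEN has_dirichlet_limits_linear,
      OF bounded_linear_mult_right[of \<i>]]
  note has_dirichlet_limits_add[OF this]
  moreover have "(\<lambda>u. complex_of_real (Re (G u)) + \<i> * complex_of_real (Im (G u))) = G"
    by (simp add: complex_eq[symmetric])
  ultimately obtain L0 R0 where "has_dirichlet_limits G d L0 R0"
    by metis
  then obtain J where L: "(G \<longlongrightarrow> L0) (at_left 0)" and R: "(G \<longlongrightarrow> R0) (at_right 0)"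
    and J: "\<And>l. 0 < l \<Longrightarrow> ((\<lambda>u. (sin (l * u) / u) *\<^sub>R G u) has_integral J l) {-d..d}"
    and Jlim: "(J \<longlongrightarrow> (pi / 2) *\<^sub>R (L0 + R0)) at_top"
    unfolding has_dirichlet_limits_def by blast
  have "(g \<longlongrightarrow> L0) (at_left a)"
    using L unfolding filterlim_at_left_to_right filterlim_at_right_to_0[of _ _ "- a"]
    by (simp add: G_def[abs_def])
  then have "left_lim g a = L0" unfolding left_lim_def by (intro tendsto_Lim) auto
  moreover have "(g \<longlongrightarrow> R0) (at_right a)"
    using R unfolding filterlim_at_right_to_0[of _ _ a] by (simp add: G_def[abs_def])
  then have "right_lim g a = R0" unfolding right_lim_def by (intro tendsto_Lim) auto
  moreover have "J l = integral {a - d..a + d} (\<lambda>y. (sin (l * (y - a)) / (y - a)) *\<^sub>R g y)" if "0 < l" for l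
    using has_integral_shift_real_ivl[OF J[OF that], of "- a"]
    by (intro integral_unique[symmetric]) (simp add: G_def add.commute)
  then have "\<forall>\<^sub>F l in at_top. J l = integral {a - d..a + d} (\<lambda>y. (sin (l * (y - a)) / (y - a)) *\<^sub>R g y)"
    by (rule eventually_mono[OF eventually_gt_at_top[of 0]])
  ultimately show ?thesis using Lim_transform_eventually[OF Jlim] by simp
qed

section \<open>The Dirichlet kernel and periodic functions\<close>

lemma periodic_shift_int:
  fixes f :: "real \<Rightarrow> 'a"
  assumes "\<And>x. f (x + 1) = f x"
  shows "f (x + of_int k) = f x"
proof -
  interpret periodic_fun_simple' f by standard (rule assms)
  show ?thesis by (rule plus_of_int)
qed

text \<open>Translating by \<open>k\<close> leaves \<open>f\<close> unchanged and multiplies the character by a constant phase.\<close>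

lemma has_integral_twisted_period:
  fixes f :: "real \<Rightarrow> complex" and k :: int and I :: complex
  assumes per: "\<And>x. f (x + 1) = f x"
    and I: "((\<lambda>x. f x * cis (- (2 * pi * x * y))) has_integral I) {-1/2..1/2}"
  shows "((\<lambda>x. f x * cis (- (2 * pi * x * y))) has_integral (I * cis (- (2 * pi * k * y)))) {k - 1/2..k + 1/2}"
proof -
  have "((\<lambda>x. f (x + - k) * cis (- (2 * pi * (x + - k) * y))) has_integral I) {-1/2 - - k..1/2 - - k}"
    by (rule has_integral_shift_real_ivl[OF I])
  then have "((\<lambda>x. f (x + - k) * cis (- (2 * pi * (x + - k) * y)) * cis (- (2 * pi * k * y)))
      has_integral (I * cis (- (2 * pi * k * y)))) {k - 1/2..k + 1/2}"
    by (intro has_integral_mult_left) (simp add: algebra_simps)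
  moreover have "f (x + - k) * cis (- (2 * pi * (x + - k) * y)) * cis (- (2 * pi * k * y))
      = f x * cis (- (2 * pi * x * y))" for x :: real
    using periodic_shift_int[of f x "- k", OF per]
    by (simp add: mult.assoc cis_mult) (simp add: algebra_simps)
  ultimately show ?thesis by simp
qed

definition dirichlet_kernel :: "nat \<Rightarrow> real \<Rightarrow> real" where
  "dirichlet_kernel N y = 1 + (\<Sum>k=1..N. 2 * cos (2 * pi * real k * y))"

text \<open>The product \<open>2 sin (\<pi>y) cos (2\<pi>ky)\<close> is a difference of sines at consecutive odd multiples of \<open>\<pi>y\<close>, so the sum
  telescopes.\<close>

lemma sin_times_dirichlet_kernel:
  "sin (pi * y) * dirichlet_kernel N y = sin ((2 * real N + 1) * pi * y)"
proof (induction N)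
  case 0
  then show ?case by (simp add: dirichlet_kernel_def)
next
  case (Suc N)
  have "sin (pi * y) * dirichlet_kernel (Suc N) y
      = sin ((2 * real N + 1) * pi * y) + 2 * (sin (pi * y) * cos (2 * pi * real (Suc N) * y))"
    using Suc by (simp add: dirichlet_kernel_def algebra_simps)
  also have "2 * (sin (pi * y) * cos (2 * pi * real (Suc N) * y))
     = sin (pi * y + 2 * pi * real (Suc N) * y) - sin (2 * pi * real (Suc N) * y - pi * y)"
    by (simp add: sin_add sin_diff)
  also have "2 * pi * real (Suc N) * y - pi * y = (2 * real N + 1) * pi * y"
    by (simp add: algebra_simps)
  also have "pi * y + 2 * pi * real (Suc N) * y = (2 * real (Suc N) + 1) * pi * y"
    by (simp add: algebra_simps)
  finally show ?case by simp
qed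

text \<open>The phases \<open>exp (-2\<pi>iky)\<close> of the \<open>2N + 1\<close> periods add up to the Dirichlet kernel.\<close>

lemma has_integral_periods:
  fixes f :: "real \<Rightarrow> complex" and I :: complex
  assumes per: "\<And>x. f (x + 1) = f x"
    and I: "((\<lambda>x. f x * cis (- (2 * pi * x * y))) has_integral I) {-1/2..1/2}"
  shows "((\<lambda>x. f x * cis (- (2 * pi * x * y))) has_integral (dirichlet_kernel N y * I))
           {- (real N + 1/2)..real N + 1/2}"
proof (induction N)
  case 0
  then show ?case using I by (simp add: dirichlet_kernel_def)
next
  case (Suc N)
  define k where "k = 1 + int N"
  have right: "((\<lambda>x. f x * cis (- (2 * pi * x * y))) has_integral (I * cis (- (2 * pi * k * y))))
      {real N + 1/2..real (Suc N) + 1/2}"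
    using has_integral_twisted_period[OF per I, of k] by (simp add: k_def algebra_simps)
  have left: "((\<lambda>x. f x * cis (- (2 * pi * x * y))) has_integral (I * cis (2 * pi * k * y)))
      {- (real (Suc N) + 1/2)..- (real N + 1/2)}"
  proof -
    have "real_of_int (- k) - 1/2 = - (real (Suc N) + 1/2)" "real_of_int (- k) + 1/2 = - (real N + 1/2)"
      by (simp_all add: k_def)
    with has_integral_twisted_period[OF per I, of "- k"] show ?thesis by (simp only:) simp
  qed
  have "((\<lambda>x. f x * cis (- (2 * pi * x * y))) has_integral
      (I * cis (2 * pi * k * y) + (dirichlet_kernel N y * I + I * cis (- (2 * pi * k * y)))))
      {- (real (Suc N) + 1/2)..real (Suc N) + 1/2}"
    by (rule has_integral_combine[OF _ _ left has_integral_combine[OF _ _ Suc.IH right]]) auto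
  moreover have "I * cis (2 * pi * k * y) + (dirichlet_kernel N y * I + I * cis (- (2 * pi * k * y)))
      = dirichlet_kernel (Suc N) y * I"
  proof -
    have "cis (2 * pi * k * y) + cis (- (2 * pi * k * y)) = of_real (2 * cos (2 * pi * real (Suc N) * y))"
    proof -
      have k_real: "real_of_int k = real (Suc N)" by (simp add: k_def)
      show ?thesis unfolding k_real by (simp add: complex_eq_iff)
    qed
    moreover have "dirichlet_kernel (Suc N) y = dirichlet_kernel N y + 2 * cos (2 * pi * real (Suc N) * y)"
      by (simp add: dirichlet_kernel_def)
    moreover have "I * cis (2 * pi * k * y) + (dirichlet_kernel N y * I + I * cis (- (2 * pi * k * y)))
        = (dirichlet_kernel N y + (cis (2 * pi * k * y) + cis (- (2 * pi * k * y)))) * I"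
      by (simp add: algebra_simps)
    ultimately show ?thesis by (simp only: of_real_add)
  qed
  ultimately show ?case by simp
qed

lemma periodic_absolutely_integrable:
  fixes f :: "real \<Rightarrow> complex"
  assumes per: "\<And>x. f (x + 1) = f x" and f: "f absolutely_integrable_on {-1/2..1/2}"
  shows "f absolutely_integrable_on {real_of_int k - 1/2..k + 1/2}"
    and "integral {real_of_int k - 1/2..k + 1/2} (\<lambda>x. norm (f x)) = integral {-1/2..1/2} (\<lambda>x. norm (f x))"
proof -
  have shift: "(h has_integral I) {real_of_int k - 1/2..k + 1/2}"
    if "(h has_integral I) {-1/2..1/2}" "\<And>x. h (x + - of_int k) = h x" for h :: "real \<Rightarrow> 'b::real_normed_vector" and I
    using has_integral_shift_real_ivl[OF that(1), of "- of_int k"] that(2) by (simp add: algebra_simps)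
  have per': "f (x + - of_int k) = f x" for x
    using periodic_shift_int[of f x "- k", OF per] by simp
  have f': "f integrable_on {-1/2..1/2}" "(\<lambda>x. norm (f x)) integrable_on {-1/2..1/2}"
    using f by (auto simp: absolutely_integrable_on_def)
  note A = shift[OF integrable_integral[OF f'(1)] per']
  have B: "((\<lambda>x. norm (f x)) has_integral integral {-1/2..1/2} (\<lambda>x. norm (f x))) {real_of_int k - 1/2..k + 1/2}"
    by (rule shift[OF integrable_integral[OF f'(2)]]) (simp only: per')
  show "f absolutely_integrable_on {real_of_int k - 1/2..k + 1/2}"
    using A B by (auto simp: absolutely_integrable_on_def)
  show "integral {real_of_int k - 1/2..k + 1/2} (\<lambda>x. norm (f x)) = integral {-1/2..1/2} (\<lambda>x. norm (f x))"
    using B by (rule integral_unique)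
qed

lemma periodic_absolutely_integrable_Icc:
  fixes f :: "real \<Rightarrow> complex"
  assumes per: "\<And>x. f (x + 1) = f x" and f: "f absolutely_integrable_on {-1/2..1/2}"
  shows "f absolutely_integrable_on {a..b}"
proof -
  obtain N :: nat where N: "\<bar>a\<bar> + \<bar>b\<bar> \<le> real N" using real_arch_simple by blast
  have "f absolutely_integrable_on (\<Union>k\<in>{-int N..int N}. {real_of_int k - 1/2..k + 1/2})"
    by (intro set_integrable_UN) (auto intro!: periodic_absolutely_integrable(1) per f)
  moreover have "{a..b} \<subseteq> (\<Union>k\<in>{-int N..int N}. {real_of_int k - 1/2..k + 1/2})"
  proof
    fix x assume x: "x \<in> {a..b}"
    have "\<bar>x - of_int (round x)\<bar> \<le> 1/2" using of_int_round_abs_le[of x] by linarith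
    moreover have "round x \<in> {-int N..int N}"
    proof -
      have "\<bar>x\<bar> \<le> N" using x N by auto
      then show ?thesis
        using round_mono[of x "of_int (int N)"] round_mono[of "of_int (- int N)" x]
        unfolding round_of_int by simp
    qed
    ultimately show "x \<in> (\<Union>k\<in>{-int N..int N}. {real_of_int k - 1/2..k + 1/2})"
      unfolding abs_le_iff by (intro UN_I[of "round x"]) auto
  qed
  ultimately show ?thesis by (intro set_integrable_subset[of lebesgue _ f "{a..b}"]) simp_all
qed

lemma norm_cis_diff_le: "norm (cis a - cis b) \<le> \<bar>a - b\<bar>"
proof -
  have "cis a - cis b = cis b * (cis (a - b) - 1)" by (simp add: right_diff_distrib cis_mult)
  then have "norm (cis a - cis b) = 2 * \<bar>sin ((a - b) / 2)\<bar>"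
    using dist_exp_i_1[of "a - b"] by (simp add: norm_mult cis_conv_exp)
  also have "\<dots> \<le> \<bar>a - b\<bar>" using abs_sin_x_le_abs_x[of "(a - b) / 2"] by simp
  finally show ?thesis .
qed

lemma fourier_transform_lipschitz:
  assumes h: "integrable lebesgue h" and supp: "\<And>x. h x \<noteq> 0 \<Longrightarrow> \<bar>x\<bar> \<le> c"
  shows "norm (fourier_transform h y - fourier_transform h z) \<le> (2 * pi * c * (LINT x|lebesgue. norm (h x))) * \<bar>y - z\<bar>"
proof -
  let ?e = "\<lambda>x y. cis (- (2 * pi * x * y))"
  have "norm (fourier_transform h y - fourier_transform h z) = norm (LINT x|lebesgue. h x * ?e x y - h x * ?e x z)"
    unfolding fourier_transform_cis
    by (subst Bochner_Integration.integral_diff) (auto intro: integrable_fourier_integrand h)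
  also have "\<dots> \<le> (LINT x|lebesgue. norm (h x * ?e x y - h x * ?e x z))"
    by (rule integral_norm_bound)
  also have "\<dots> \<le> (LINT x|lebesgue. (2 * pi * c * \<bar>y - z\<bar>) * norm (h x))"
  proof (rule integral_mono)
    show "integrable lebesgue (\<lambda>x. norm (h x * ?e x y - h x * ?e x z))"
      by (intro integrable_norm Bochner_Integration.integrable_diff integrable_fourier_integrand h)
    show "integrable lebesgue (\<lambda>x. (2 * pi * c * \<bar>y - z\<bar>) * norm (h x))"
      using h by simp
    fix x
    show "norm (h x * ?e x y - h x * ?e x z) \<le> (2 * pi * c * \<bar>y - z\<bar>) * norm (h x)"
    proof (cases "h x = 0")
      case False
      have "norm (?e x y - ?e x z) \<le> \<bar>2 * pi * x * (z - y)\<bar>"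
        using norm_cis_diff_le[of "- (2 * pi * x * y)" "- (2 * pi * x * z)"] by (simp add: algebra_simps)
      also have "\<dots> = 2 * pi * \<bar>x\<bar> * \<bar>y - z\<bar>" by (simp add: abs_mult abs_minus_commute)
      also have "\<dots> \<le> 2 * pi * c * \<bar>y - z\<bar>"
        using supp[OF False] by (intro mult_right_mono mult_left_mono) auto
      finally have "norm (h x) * norm (?e x y - ?e x z) \<le> norm (h x) * (2 * pi * c * \<bar>y - z\<bar>)"
        by (rule mult_left_mono) simp
      then show ?thesis by (simp add: mult.commute flip: right_diff_distrib norm_mult)
    qed simp
  qed
  also have "\<dots> = (2 * pi * c * (LINT x|lebesgue. norm (h x))) * \<bar>y - z\<bar>" by simp
  finally show ?thesis .
qed

lemma riemann_lebesgue_sin: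
  fixes h :: "real \<Rightarrow> complex"
  assumes h: "integrable lebesgue h"
  shows "((\<lambda>l. LINT y|lebesgue. h y * of_real (sin (l * y))) \<longlongrightarrow> 0) at_top"
proof -
  have eq: "(LINT y|lebesgue. h y * of_real (sin (l * y)))
      = (fourier_transform h (- l / (2 * pi)) - fourier_transform h (l / (2 * pi))) / (2 * \<i>)" for l
  proof -
    have "(\<lambda>y. h y * of_real (sin (l * y)))
        = (\<lambda>y. (h y * cis (- (2 * pi * y * (- l / (2 * pi)))) - h y * cis (- (2 * pi * y * (l / (2 * pi))))) / (2 * \<i>))"
    proof
      fix y
      have "cis (- (2 * pi * y * (- l / (2 * pi)))) - cis (- (2 * pi * y * (l / (2 * pi)))) = of_real (sin (l * y)) * (2 * \<i>)"
        by (simp add: complex_eq_iff mult.commute)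
      then have "h y * cis (- (2 * pi * y * (- l / (2 * pi)))) - h y * cis (- (2 * pi * y * (l / (2 * pi))))
          = h y * of_real (sin (l * y)) * (2 * \<i>)"
        by (simp only: right_diff_distrib[symmetric] mult.assoc)
      then show "h y * of_real (sin (l * y))
        = (h y * cis (- (2 * pi * y * (- l / (2 * pi)))) - h y * cis (- (2 * pi * y * (l / (2 * pi))))) / (2 * \<i>)"
        by (simp only:) (rule nonzero_mult_div_cancel_right[symmetric], simp)
    qed
    then show ?thesis
      unfolding fourier_transform_cis
      by (simp only: integral_divide_zero Bochner_Integration.integral_diff integrable_fourier_integrand h)
  qed
  have top: "filterlim (\<lambda>l::real. l / (2 * pi)) at_top at_top"
    using filterlim_tendsto_pos_mult_at_top[OF tendsto_const[of "1 / (2 * pi)"] _ filterlim_ident] by simp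
  then have "filterlim (\<lambda>l::real. l / (2 * pi)) at_infinity at_top"
    by (rule filterlim_at_top_imp_at_infinity)
  moreover have "filterlim (\<lambda>l::real. - l / (2 * pi)) at_infinity at_top"
    using top by (intro filterlim_at_bot_imp_at_infinity) (simp add: filterlim_uminus_at_top)
  ultimately have "((\<lambda>l. (fourier_transform h (- l / (2 * pi)) - fourier_transform h (l / (2 * pi))) / (2 * \<i>)) \<longlongrightarrow> (0 - 0) / (2 * \<i>)) at_top"
    by (intro tendsto_intros filterlim_compose[OF riemann_lebesgue[OF h]]) auto
  then show ?thesis unfolding eq by simp
qed

section \<open>Convergence of Dirichlet kernel integrals\<close>

lemma sin_small_bounds:
  fixes t :: real
  assumes "\<bar>t\<bar> \<le> 1"
  shows "\<bar>t\<bar> / 2 \<le> \<bar>sin t\<bar>" "\<bar>1 / sin t - 1 / t\<bar> \<le> 1"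
proof -
  have quad: "\<bar>sin t - t\<bar> \<le> \<bar>t\<bar> ^ 2 / 2"
    using Maclaurin_sin_bound[of t 2] by (simp add: sin_coeff_def eval_nat_numeral)
  have "\<bar>t\<bar> ^ 2 \<le> \<bar>t\<bar>" using mult_right_mono[OF assms, of "\<bar>t\<bar>"] by (simp add: power2_eq_square)
  then show half: "\<bar>t\<bar> / 2 \<le> \<bar>sin t\<bar>" using quad by linarith
  show "\<bar>1 / sin t - 1 / t\<bar> \<le> 1"
  proof (cases "t = 0")
    case False
    then have s: "sin t \<noteq> 0" using half by auto
    have "\<bar>1 / sin t - 1 / t\<bar> = \<bar>sin t - t\<bar> / (\<bar>sin t\<bar> * \<bar>t\<bar>)"
      using False s by (simp add: diff_frac_eq abs_mult abs_minus_commute)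
    also have "\<dots> \<le> (\<bar>t\<bar> ^ 2 / 2) / (\<bar>t\<bar> / 2 * \<bar>t\<bar>)"
    proof (rule frac_le)
      show "0 < \<bar>t\<bar> / 2 * \<bar>t\<bar>" using False by (intro mult_pos_pos) auto
      show "\<bar>t\<bar> / 2 * \<bar>t\<bar> \<le> \<bar>sin t\<bar> * \<bar>t\<bar>" using half by (rule mult_right_mono) simp
    qed (use quad in auto)
    also have "\<dots> = 1" using False by (simp add: power2_eq_square)
    finally show ?thesis .
  qed simp
qed

lemma finite_int_abs_le: "finite {n::int. \<bar>real_of_int n\<bar> \<le> A}"
proof (rule finite_subset)
  show "{n::int. \<bar>real_of_int n\<bar> \<le> A} \<subseteq> {- \<lceil>A\<rceil>..\<lceil>A\<rceil>}"
    by (auto simp: abs_le_iff) linarith+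
qed simp

lemma sin_pi_times_shift: "sin (pi * y) = cos (pi * of_int n) * sin (pi * (y - of_int n))"
proof -
  have "sin (pi * of_int n) = 0" by (simp add: sin_zero_iff_int2 mult.commute)
  then show ?thesis
    using sin_add[of "pi * (y - of_int n)" "pi * of_int n"] by (simp add: algebra_simps)
qed

lemma cos_pi_int_square: "cos (pi * of_int n) * cos (pi * of_int n) = 1"
proof -
  have "sin (pi * of_int n) = 0" by (simp add: sin_zero_iff_int2 mult.commute)
  then show ?thesis using sin_cos_squared_add[of "pi * of_int n"] by (simp add: power2_eq_square)
qed

lemma sin_odd_pi_shift:
  "sin ((2 * real N + 1) * pi * (y - of_int n)) = cos (pi * of_int n) * sin ((2 * real N + 1) * pi * y)"
proof -
  let ?l = "(2 * real N + 1) * pi"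
  have arg: "?l * of_int n = pi * of_int ((2 * int N + 1) * n)" by simp
  have "sin (?l * of_int n) = 0" unfolding arg by (rule sin_npi_int)
  moreover have "cos (?l * of_int n) = cos (pi * of_int n)"
  proof -
    have "?l * of_int n = pi * of_int n + of_int (int N * n) * (2 * pi)" by (simp add: algebra_simps)
    then show ?thesis using cos.plus_of_int[of "pi * of_int n" "int N * n"] by (simp add: mult.commute)
  qed
  ultimately show ?thesis
    using sin_diff[of "?l * y" "?l * of_int n"] by (simp add: right_diff_distrib)
qed

text \<open>Write \<open>t = \<pi>(y - n)\<close>. Up to the sign \<open>cos (\<pi>n)\<close> the difference is
  \<open>(\<phi>(y) - \<phi>(n)) / sin t + \<phi>(n) (1 / sin t - 1 / t)\<close>; the Lipschitz bound controls the first term, and the second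
  factor of the other one is bounded near zero.
  At \<open>y = n\<close> both quotients are zero by the convention for division by zero, so the bound holds there as well.\<close>

lemma singular_quotient_bound:
  fixes \<phi> :: "real \<Rightarrow> complex"
  assumes lip: "\<And>y z. norm (\<phi> y - \<phi> z) \<le> C * \<bar>y - z\<bar>" and near: "\<bar>y - of_int n\<bar> \<le> 1/4"
  shows "norm (\<phi> y / of_real (sin (pi * y))
        - of_real (cos (pi * of_int n)) * \<phi> (of_int n) / of_real (pi * (y - of_int n)))
      \<le> C + norm (\<phi> (of_int n))"
proof -
  define u where "u = y - of_int n"
  define t where "t = pi * u"
  have C0: "0 \<le> C" using order_trans[OF norm_ge_zero lip[of 1 0]] by simp
  have "\<bar>t\<bar> \<le> pi * (1/4)" using near unfolding t_def u_def abs_mult by (intro mult_mono) auto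
  also have "\<dots> \<le> 1" using pi_less_4 by simp
  finally have t: "\<bar>t\<bar> \<le> 1" .
  show ?thesis
  proof (cases "u = 0")
    case True
    then have "y = of_int n" by (simp add: u_def)
    moreover have "sin (pi * of_int n) = 0" by (simp add: sin_zero_iff_int2 mult.commute)
    ultimately show ?thesis using C0 by simp
  next
    case False
    define \<epsilon> where "\<epsilon> = cos (pi * of_int n)"
    have \<epsilon>: "\<epsilon> * \<epsilon> = 1" using cos_pi_int_square by (simp add: \<epsilon>_def)
    then have \<epsilon>1: "\<bar>\<epsilon>\<bar> = 1" and "\<epsilon> \<noteq> 0"
      using abs_square_eq_1[of \<epsilon>] by (auto simp: power2_eq_square)
    have "\<phi> y / of_real (sin (pi * y)) = of_real \<epsilon> * (\<phi> y / of_real (sin t))"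
    proof -
      have "sin (pi * y) = \<epsilon> * sin t"
        using sin_pi_times_shift[of y n] by (simp add: \<epsilon>_def t_def u_def)
      then have "\<phi> y / of_real (sin (pi * y)) = of_real (1 / \<epsilon>) * (\<phi> y / of_real (sin t))" by simp
      moreover have "1 / \<epsilon> = \<epsilon>" using \<epsilon> \<open>\<epsilon> \<noteq> 0\<close> by (simp add: divide_eq_eq)
      ultimately show ?thesis by (simp only:)
    qed
    then have "\<phi> y / of_real (sin (pi * y)) - of_real \<epsilon> * \<phi> (of_int n) / of_real t
        = of_real \<epsilon> * ((\<phi> y - \<phi> (of_int n)) / of_real (sin t) + \<phi> (of_int n) * of_real (1 / sin t - 1 / t))"
      by (simp add: algebra_simps diff_divide_distrib)
    then have "norm (\<phi> y / of_real (sin (pi * y)) - of_real \<epsilon> * \<phi> (of_int n) / of_real t)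
        = norm ((\<phi> y - \<phi> (of_int n)) / of_real (sin t) + \<phi> (of_int n) * of_real (1 / sin t - 1 / t))"
      by (simp only: norm_mult norm_of_real \<epsilon>1 mult_1)
    also have "\<dots> \<le> norm (\<phi> y - \<phi> (of_int n)) / \<bar>sin t\<bar> + norm (\<phi> (of_int n)) * \<bar>1 / sin t - 1 / t\<bar>"
      by (rule norm_triangle_le) (simp only: norm_divide norm_mult norm_of_real order_refl)
    also have "\<dots> \<le> C + norm (\<phi> (of_int n)) * 1"
    proof (rule add_mono)
      have "norm (\<phi> y - \<phi> (of_int n)) \<le> C * \<bar>u\<bar>" using lip by (simp add: u_def)
      also have "\<dots> \<le> C * \<bar>sin t\<bar>"
      proof (rule mult_left_mono[OF _ C0])
        have "2 * \<bar>u\<bar> \<le> pi * \<bar>u\<bar>" using pi_gt3 by (intro mult_right_mono) auto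
        then show "\<bar>u\<bar> \<le> \<bar>sin t\<bar>" using sin_small_bounds(1)[OF t] by (simp add: t_def abs_mult)
      qed
      finally have "norm (\<phi> y - \<phi> (of_int n)) \<le> C * \<bar>sin t\<bar>" .
      moreover have "0 < \<bar>sin t\<bar>" using sin_small_bounds(1)[OF t] False by (auto simp: t_def)
      ultimately show "norm (\<phi> y - \<phi> (of_int n)) / \<bar>sin t\<bar> \<le> C" by (simp add: pos_divide_le_eq)
      show "norm (\<phi> (of_int n)) * \<bar>1 / sin t - 1 / t\<bar> \<le> norm (\<phi> (of_int n)) * 1"
        using sin_small_bounds(2)[OF t] by (intro mult_left_mono) auto
    qed
    finally show ?thesis by (simp add: \<epsilon>_def t_def u_def)
  qed
qed

text \<open>Let \<open>I n\<close> be small disjoint intervals around the integers in \<open>{-A..A}\<close>. The quotient \<open>\<phi>(y) / sin (\<pi>y)\<close> is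
  made bounded on \<open>{-A..A}\<close> by subtracting the poles \<open>s n\<close> on the \<open>I n\<close>. Multiplied by \<open>g(y) sin (\<lambda>y)\<close>, the bounded
  remainder \<open>q\<close> falls under the Riemann-Lebesgue lemma, and the poles become the Dirichlet integrals \<open>T n\<close> around the
  integers.\<close>

theorem dirichlet_kernel_convergence:
  fixes g \<phi> :: "real \<Rightarrow> complex" and A :: real
  assumes g: "integrable lebesgue g" and supp: "\<And>y. g y \<noteq> 0 \<Longrightarrow> \<bar>y\<bar> \<le> A"
    and bv: "\<And>n::int. \<bar>real_of_int n\<bar> \<le> A \<Longrightarrow> locally_bounded_variation_at g (real_of_int n)"
    and lip: "\<And>y z. norm (\<phi> y - \<phi> z) \<le> C * \<bar>y - z\<bar>"
  shows "(\<lambda>N. LINT y|lebesgue. g y * (dirichlet_kernel N y * \<phi> y)) \<longlonglongrightarrow>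
      (\<Sum>n\<in>{n::int. \<bar>real_of_int n\<bar> \<le> A}. \<phi> (of_int n) * ((left_lim g (of_int n) + right_lim g (of_int n)) / 2))"
proof -
  define Z where "Z = {n::int. \<bar>real_of_int n\<bar> \<le> A}"
  have Z: "finite Z" unfolding Z_def by (rule finite_int_abs_le)
  have "\<exists>d>0. d \<le> 1/4 \<and> bounded_variation_on g {real_of_int n - d..real_of_int n + d}" if n: "n \<in> Z" for n
  proof -
    obtain e where e: "0 < e" "bounded_variation_on g {real_of_int n - e..real_of_int n + e}"
      using bv n unfolding Z_def locally_bounded_variation_at_def by blast
    have "bounded_variation_on g {real_of_int n - min e (1/4)..real_of_int n + min e (1/4)}"
      by (rule bounded_variation_on_subset[OF e(2)]) auto
    then show ?thesis using e(1) by (intro exI[of _ "min e (1/4)"]) auto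
  qed
  then obtain d where d: "\<And>n. n \<in> Z \<Longrightarrow> 0 < d n" "\<And>n. n \<in> Z \<Longrightarrow> d n \<le> 1/4"
    "\<And>n. n \<in> Z \<Longrightarrow> bounded_variation_on g {real_of_int n - d n..real_of_int n + d n}"
    by metis
  define I where "I n = {real_of_int n - d n..real_of_int n + d n}" for n
  define s where "s n y = of_real (cos (pi * of_int n)) * \<phi> (of_int n) / of_real (pi * (y - of_int n))" for n :: int and y
  define q where "q y = indicator {-A..A} y * (\<phi> y / of_real (sin (pi * y)) - (\<Sum>n\<in>Z. indicator (I n) y * s n y))" for y
  have I_disjoint: "m = n" if "m \<in> Z" "n \<in> Z" "y \<in> I m" "y \<in> I n" for m n y
  proof -
    have "\<bar>real_of_int m - real_of_int n\<bar> < 1" using that d(2)[of m] d(2)[of n] by (auto simp: I_def)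
    then show ?thesis by linarith
  qed
  have cont: "continuous_on UNIV \<phi>"
    using lipschitz_on_continuous_on[of C UNIV \<phi>] order_trans[OF norm_ge_zero lip[of 1 0]] lip
    by (auto simp: lipschitz_on_def dist_norm)
  then have meas_phi [measurable]: "\<phi> \<in> borel_measurable borel"
    by (rule borel_measurable_continuous_onI)
  obtain B where B: "\<And>y. norm (q y) \<le> B"
  proof -
    \<comment> \<open>\<open>K\<close> is compact and contains no zero of \<open>sin (\<pi>y)\<close>, which keeps the quotient bounded there\<close>
    define K where "K = {-A..A} - (\<Union>n\<in>Z. {real_of_int n - d n<..<real_of_int n + d n})"
    have "compact K" unfolding K_def by (intro compact_diff compact_Icc open_UN) auto
    have nz: "sin (pi * y) \<noteq> 0" if "y \<in> K" for y
    proof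
      assume "sin (pi * y) = 0"
      then obtain n :: int where "y = of_int n" by (auto simp: sin_zero_iff_int2)
      moreover from this that have "n \<in> Z" by (auto simp: K_def Z_def)
      ultimately show False using that d(1)[of n] by (auto simp: K_def)
    qed
    have "compact ((\<lambda>y. \<phi> y / of_real (sin (pi * y))) ` K)"
      by (intro compact_continuous_image continuous_intros continuous_on_subset[OF cont] \<open>compact K\<close>) (auto dest: nz)
    then obtain B1 where B1: "\<And>y. y \<in> K \<Longrightarrow> norm (\<phi> y / of_real (sin (pi * y))) \<le> B1"
      by (meson bounded_iff compact_imp_bounded image_eqI)
    have "norm (q y) \<le> max 0 (max B1 (C + (\<Sum>n\<in>Z. norm (\<phi> (of_int n)))))" for y
    proof -
      consider "y \<notin> {-A..A}" | n where "y \<in> {-A..A}" "n \<in> Z" "y \<in> I n"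
        | "y \<in> {-A..A}" "\<And>n. n \<in> Z \<Longrightarrow> y \<notin> I n" by blast
      then show ?thesis
      proof cases
        case 1
        then show ?thesis by (simp add: q_def)
      next
        case (2 n)
        have "(\<Sum>m\<in>Z. indicator (I m) y * s m y) = (\<Sum>m\<in>{n}. indicator (I m) y * s m y)"
          using Z 2 I_disjoint by (intro sum.mono_neutral_right) (auto simp: indicator_def)
        then have "q y = \<phi> y / of_real (sin (pi * y)) - s n y"
          using 2 by (simp add: q_def)
        moreover have "\<bar>y - of_int n\<bar> \<le> 1/4"
        proof -
          have "y \<le> of_int n + d n" "of_int n - d n \<le> y" using 2 by (auto simp: I_def)
          then show ?thesis using d(2)[OF 2(2)] by linarith
        qed
        ultimately have "norm (q y) \<le> C + norm (\<phi> (of_int n))"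
          using singular_quotient_bound[of \<phi> C y n, OF lip] by (simp add: s_def)
        also have "norm (\<phi> (of_int n)) \<le> (\<Sum>n\<in>Z. norm (\<phi> (of_int n)))"
          using Z 2 by (intro member_le_sum) auto
        finally show ?thesis by simp
      next
        case 3
        then have "y \<in> K" by (force simp: K_def I_def)
        moreover have "q y = \<phi> y / of_real (sin (pi * y))"
          using 3 by (simp add: q_def)
        ultimately show ?thesis using B1[of y] by simp
      qed
    qed
    then show thesis by (rule that)
  qed
  have "I n \<in> sets borel" for n by (simp add: I_def)
  then have "q \<in> borel_measurable borel"
    unfolding q_def s_def by measurable
  then have gq: "integrable lebesgue (\<lambda>y. g y * q y)"
    by (intro integrable_bounded_factor[OF g _ B] lebesgue_measurable_of_borel)
  define l where "l N = (2 * real N + 1) * pi" for N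
  have l: "filterlim l at_top sequentially"
  proof (rule filterlim_at_top_mono[OF filterlim_real_sequentially], rule always_eventually, rule allI)
    fix N
    have "(2 * real N + 1) * 1 \<le> (2 * real N + 1) * pi" using pi_gt3 by (intro mult_left_mono) auto
    then show "real N \<le> l N" unfolding l_def mult_1_right by linarith
  qed
  define T where "T n N y = indicator (I n) y *\<^sub>R ((sin (l N * (y - of_int n)) / (y - of_int n)) *\<^sub>R g y)" for n N y
  have T_int: "integrable lebesgue (T n N)" for n N
  proof -
    have "norm (sin (l N * u) / u) \<le> \<bar>l N\<bar>" for u
      using abs_sin_x_le_abs_x[of "l N * u"] by (cases "u = 0") (auto simp: abs_mult pos_divide_le_eq)
    then have "norm (complex_of_real (indicator (I n) y * (sin (l N * (y - of_int n)) / (y - of_int n)))) \<le> \<bar>l N\<bar>" for y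
      unfolding norm_of_real by (cases "y \<in> I n") (simp_all only: indicator_simps mult_1 real_norm_def, simp)
    then have "integrable lebesgue (\<lambda>y. g y * of_real (indicator (I n) y * (sin (l N * (y - of_int n)) / (y - of_int n))))"
      by (intro integrable_bounded_factor[OF g, of _ "\<bar>l N\<bar>"] lebesgue_measurable_of_borel) (simp add: I_def)
    then show ?thesis by (simp add: T_def[abs_def] scaleR_conv_of_real mult_ac)
  qed
  have T_lim: "(\<lambda>N. LINT y|lebesgue. T n N y) \<longlonglongrightarrow> (pi / 2) *\<^sub>R (left_lim g (of_int n) + right_lim g (of_int n))"
    if n: "n \<in> Z" for n
  proof -
    have "(LINT y|lebesgue. T n N y) = integral (I n) (\<lambda>y. (sin (l N * (y - of_int n)) / (y - of_int n)) *\<^sub>R g y)" for N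
      using set_lebesgue_integral_eq_integral(2)[of "I n" "\<lambda>y. (sin (l N * (y - of_int n)) / (y - of_int n)) *\<^sub>R g y"] T_int[of n N]
      by (simp add: set_integrable_def set_lebesgue_integral_def T_def[abs_def])
    then show ?thesis
      using filterlim_compose[OF dirichlet_jordan[OF d(3)[OF n] d(1)[OF n]] l] by (simp add: I_def)
  qed
  have decomposition: "(LINT y|lebesgue. g y * (dirichlet_kernel N y * \<phi> y))
      = (\<Sum>n\<in>Z. \<phi> (of_int n) / pi * (LINT y|lebesgue. T n N y))
        + (LINT y|lebesgue. g y * q y * of_real (sin (l N * y)))" for N
  proof -
    have gqs: "integrable lebesgue (\<lambda>y. g y * q y * of_real (sin (l N * y)))"
      by (rule integrable_bounded_factor[OF gq, where B = 1]) (auto intro!: lebesgue_measurable_of_borel)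
    have D: "dirichlet_kernel N \<in> borel_measurable borel"
      unfolding dirichlet_kernel_def by measurable
    have point: "g y * (dirichlet_kernel N y * \<phi> y)
        = (\<Sum>n\<in>Z. \<phi> (of_int n) / pi * T n N y) + g y * q y * of_real (sin (l N * y))" if "y \<notin> \<int>" for y
    proof (cases "g y = 0")
      case False
      then have y: "y \<in> {-A..A}" using supp[of y] by auto
      have "sin (pi * y) \<noteq> 0" using that by (auto simp: sin_zero_iff_int2)
      then have Dy: "dirichlet_kernel N y = sin (l N * y) / sin (pi * y)"
        using sin_times_dirichlet_kernel[of y N] by (simp add: l_def field_simps)
      have Ty: "\<phi> (of_int n) / pi * T n N y = g y * of_real (sin (l N * y)) * (indicator (I n) y * s n y)" for n
        unfolding T_def s_def l_def sin_odd_pi_shift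
        by (auto simp: indicator_def scaleR_conv_of_real mult_ac)
      show ?thesis
        unfolding Ty sum_distrib_left[symmetric] Dy q_def using y by (simp add: algebra_simps)
    qed (simp add: T_def)
    have "(LINT y|lebesgue. g y * (dirichlet_kernel N y * \<phi> y))
       = (LINT y|lebesgue. (\<Sum>n\<in>Z. \<phi> (of_int n) / pi * T n N y) + g y * q y * of_real (sin (l N * y)))"
    proof (rule integral_cong_AE)
      show "(\<lambda>y. g y * (dirichlet_kernel N y * \<phi> y)) \<in> borel_measurable lebesgue"
      proof (rule borel_measurable_times[OF borel_measurable_integrable[OF g] lebesgue_measurable_of_borel])
        show "(\<lambda>y. dirichlet_kernel N y * \<phi> y) \<in> borel_measurable borel" using D by measurable
      qed
      show "(\<lambda>y. (\<Sum>n\<in>Z. \<phi> (of_int n) / pi * T n N y) + g y * q y * of_real (sin (l N * y))) \<in> borel_measurable lebesgue"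
        using T_int gqs by (intro borel_measurable_integrable Bochner_Integration.integrable_add
            Bochner_Integration.integrable_sum integrable_mult_right) auto
      \<comment> \<open>At integers the closed form of the kernel degenerates to \<open>0 / 0\<close>, but they form a null set\<close>
      have "AE y in lborel. y \<notin> (\<int> :: real set)"
        by (rule AE_not_in[OF countable_imp_null_set_lborel]) (simp add: Ints_def)
      then have "AE y in lebesgue. y \<notin> (\<int> :: real set)" by (rule AE_completion)
      then show "AE y in lebesgue. g y * (dirichlet_kernel N y * \<phi> y)
          = (\<Sum>n\<in>Z. \<phi> (of_int n) / pi * T n N y) + g y * q y * of_real (sin (l N * y))"
        by eventually_elim (rule point)
    qed
    also have "\<dots> = (LINT y|lebesgue. (\<Sum>n\<in>Z. \<phi> (of_int n) / pi * T n N y))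
        + (LINT y|lebesgue. g y * q y * of_real (sin (l N * y)))"
      using T_int gqs by (intro Bochner_Integration.integral_add Bochner_Integration.integrable_sum integrable_mult_right) auto
    also have "(LINT y|lebesgue. (\<Sum>n\<in>Z. \<phi> (of_int n) / pi * T n N y))
        = (\<Sum>n\<in>Z. \<phi> (of_int n) / pi * (LINT y|lebesgue. T n N y))"
      using T_int by (subst Bochner_Integration.integral_sum) auto
    finally show ?thesis .
  qed
  have "(\<lambda>N. LINT y|lebesgue. g y * (dirichlet_kernel N y * \<phi> y)) \<longlonglongrightarrow>
      (\<Sum>n\<in>Z. \<phi> (of_int n) / pi * ((pi / 2) *\<^sub>R (left_lim g (of_int n) + right_lim g (of_int n)))) + 0"
    unfolding decomposition
    by (intro tendsto_add tendsto_sum tendsto_mult tendsto_const T_lim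
        filterlim_compose[OF riemann_lebesgue_sin[OF gq] l])
  then show ?thesis by (simp add: Z_def scaleR_conv_of_real)
qed

section \<open>Symmetric improper integrals against a periodic function\<close>

lemma norm_integral_period_le:
  fixes f k :: "real \<Rightarrow> complex"
  assumes per: "\<And>x. f (x + 1) = f x" and f: "f absolutely_integrable_on {-1/2..1/2}"
    and fk: "(\<lambda>x. f x * k x) integrable_on {a..b}"
    and sub: "{a..b} \<subseteq> {of_int n - 1/2..of_int n + 1/2}"
    and e: "0 \<le> e" "\<And>x. x \<in> {a..b} \<Longrightarrow> norm (k x) \<le> e"
  shows "norm (integral {a..b} (\<lambda>x. f x * k x)) \<le> e * integral {-1/2..1/2} (\<lambda>x. norm (f x))"
proof -
  have i: "(\<lambda>x. norm (f x)) integrable_on {of_int n - 1/2..of_int n + 1/2}"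
    using periodic_absolutely_integrable(1)[OF per f, of n] by (simp add: absolutely_integrable_on_def)
  then have i': "(\<lambda>x. norm (f x)) integrable_on {a..b}"
    using sub by (rule integrable_on_subinterval)
  have "norm (integral {a..b} (\<lambda>x. f x * k x)) \<le> integral {a..b} (\<lambda>x. e * norm (f x))"
  proof (rule integral_norm_bound_integral[OF fk])
    show "(\<lambda>x. e * norm (f x)) integrable_on {a..b}"
      using integrable_cmul[OF i', of e] by simp
    show "norm (f x * k x) \<le> e * norm (f x)" if "x \<in> {a..b}" for x
      using mult_right_mono[OF e(2)[OF that] norm_ge_zero[of "f x"]] by (simp add: norm_mult mult.commute)
  qed
  also have "\<dots> = e * integral {a..b} (\<lambda>x. norm (f x))" by simp
  also have "\<dots> \<le> e * integral {of_int n - 1/2..of_int n + 1/2} (\<lambda>x. norm (f x))"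
    using e(1) i i' sub by (intro mult_left_mono integral_subset_le) auto
  also have "\<dots> = e * integral {-1/2..1/2} (\<lambda>x. norm (f x))"
    using periodic_absolutely_integrable(2)[OF per f, of n] by simp
  finally show ?thesis .
qed

text \<open>Every large \<open>R\<close> lies between some \<open>N + 1/2\<close> and \<open>N + 3/2\<close>. Then \<open>{-R..R}\<close> exceeds the symmetric interval of
  \<open>2N + 1\<close> periods by a part of one period on either side, and \<open>k\<close> is uniformly small there.\<close>

lemma tendsto_symmetric_integral_periodic:
  fixes f k :: "real \<Rightarrow> complex"
  assumes per: "\<And>x. f (x + 1) = f x" and f: "f absolutely_integrable_on {-1/2..1/2}"
    and fk: "\<And>R. (\<lambda>x. f x * k x) integrable_on {-R..R}" and k: "(k \<longlongrightarrow> 0) at_infinity"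
    and lim: "(\<lambda>N. integral {- (real N + 1/2)..real N + 1/2} (\<lambda>x. f x * k x)) \<longlonglongrightarrow> S"
  shows "((\<lambda>R. integral {-R..R} (\<lambda>x. f x * k x)) \<longlongrightarrow> S) at_top"
proof (rule tendstoI)
  fix e :: real assume "0 < e"
  define F where "F = integral {-1/2..1/2} (\<lambda>x. norm (f x))"
  have F: "0 \<le> F" unfolding F_def using f by (intro integral_nonneg) (auto simp: absolutely_integrable_on_def)
  \<comment> \<open>\<open>F + 1\<close> instead of \<open>F\<close> because \<open>F\<close> may be zero\<close>
  define e1 where "e1 = e / 4 / (F + 1)"
  have e1: "0 < e1" using \<open>0 < e\<close> F by (simp add: e1_def)
  have "2 * (e1 * F) \<le> 2 * (e1 * (F + 1))" using e1 by (intro mult_left_mono) auto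
  also have "e1 * (F + 1) = e / 4"
    using F nonzero_eq_divide_eq[of "F + 1" e1 "e / 4"] unfolding e1_def by linarith
  also have "2 * (e / 4) = e / 2" by simp
  finally have e1F: "2 * (e1 * F) \<le> e / 2" .
  obtain b where b: "\<And>x. b \<le> \<bar>x\<bar> \<Longrightarrow> norm (k x) < e1"
    using tendstoD[OF k e1] by (auto simp: eventually_at_infinity)
  obtain N0 where N0: "\<And>N. N0 \<le> N \<Longrightarrow>
      dist (integral {- (real N + 1/2)..real N + 1/2} (\<lambda>x. f x * k x)) S < e / 2"
    using tendstoD[OF lim, of "e / 2"] \<open>0 < e\<close> by (auto simp: eventually_sequentially)
  show "\<forall>\<^sub>F R in at_top. dist (integral {-R..R} (\<lambda>x. f x * k x)) S < e"
    using eventually_ge_at_top[of "max (real N0) \<bar>b\<bar> + 2"]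
  proof eventually_elim
    case (elim R)
    define N where "N = nat \<lfloor>R - 1/2\<rfloor>"
    have N: "real N + 1/2 \<le> R" "R \<le> real N + 3/2"
      using elim by (auto simp: N_def) linarith+
    then have "N0 \<le> N" "\<bar>b\<bar> \<le> real N + 1/2" using elim by auto
    let ?h = "\<lambda>x. f x * k x" and ?r = "real N + 1/2"
    have h: "?h integrable_on {a..b}" if "-R \<le> a" "b \<le> R" for a b
      using integrable_on_subinterval[OF fk[of R], of a b] that by auto
    have right: "norm (integral {?r..R} ?h) \<le> e1 * F"
      unfolding F_def
      by (rule norm_integral_period_le[OF per f, of k _ _ "int N + 1"])
         (use N \<open>\<bar>b\<bar> \<le> real N + 1/2\<close> e1 in \<open>auto intro!: h less_imp_le[OF b]\<close>)
    have left: "norm (integral {-R..-?r} ?h) \<le> e1 * F"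
      unfolding F_def
      by (rule norm_integral_period_le[OF per f, of k _ _ "- (int N + 1)"])
         (use N \<open>\<bar>b\<bar> \<le> real N + 1/2\<close> e1 in \<open>auto intro!: h less_imp_le[OF b]\<close>)
    have "integral {-R..R} ?h = integral {-R..-?r} ?h + integral {-?r..R} ?h"
      using N h by (intro Henstock_Kurzweil_Integration.integral_combine[symmetric]) auto
    also have "integral {-?r..R} ?h = integral {-?r..?r} ?h + integral {?r..R} ?h"
      using N h by (intro Henstock_Kurzweil_Integration.integral_combine[symmetric]) auto
    finally have "integral {-R..R} ?h - S = (integral {-?r..?r} ?h - S) + (integral {-R..-?r} ?h + integral {?r..R} ?h)"
      by simp
    then have "norm (integral {-R..R} ?h - S) \<le> norm (integral {-?r..?r} ?h - S)
        + (norm (integral {-R..-?r} ?h) + norm (integral {?r..R} ?h))"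
      by (simp only:) (intro norm_triangle_le add_left_mono norm_triangle_ineq)
    also have "\<dots> < e"
      using N0[OF \<open>N0 \<le> N\<close>] left right e1F unfolding dist_norm by linarith
    finally show ?case by (simp add: dist_norm)
  qed
qed

theorem theorem2:
  fixes f g :: "real \<Rightarrow> complex" and A :: real
  assumes f_periodic: "\<And>x. f (x + 1) = f x"
    and f_integrable: "f absolutely_integrable_on {-1/2..1/2}"
    and g_integrable: "integrable lebesgue g"
    and A_pos: "A > 0"
    and g_support: "closure (support_on UNIV g) \<subseteq> {-A..A}"
    and g_bv: "\<And>n::int. \<bar>real_of_int n\<bar> \<le> A \<Longrightarrow> locally_bounded_variation_at g (real_of_int n)"
  shows "(\<lambda>x. f x * fourier_transform g x) has_symmetric_integral
           (\<Sum>n\<in>{n::int. \<bar>real_of_int n\<bar> \<le> A}.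
              fourier_coeff f n * ((left_lim g (real_of_int n) + right_lim g (real_of_int n)) / 2))"
proof -
  let ?h = "\<lambda>x. f x * fourier_transform g x"
  have supp: "\<bar>y\<bar> \<le> A" if "g y \<noteq> 0" for y
  proof -
    have "y \<in> closure (support_on UNIV g)"
      using that closure_subset[of "support_on UNIV g"] by (auto simp: support_on_def)
    then have "y \<in> {-A..A}" using g_support by blast
    then show ?thesis by auto
  qed
  \<comment> \<open>Truncations of \<open>f\<close>; the one with \<open>a = 1/2\<close> is a single period\<close>
  define cut where "cut a x = indicator {-a..a} x *\<^sub>R f x" for a x :: real
  have cut_int: "integrable lebesgue (cut a)" for a
    using periodic_absolutely_integrable_Icc[OF f_periodic f_integrable, of "-a" a]
    by (simp add: set_integrable_def cut_def[abs_def])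
  have cut_h: "cut a x * fourier_transform g x = indicator {-a..a} x *\<^sub>R ?h x" for a x
    by (simp add: cut_def)
  have h_int: "?h absolutely_integrable_on {-a..a}" for a
    using multiplication_formula(1)[OF cut_int g_integrable, of a]
    unfolding cut_h by (simp add: set_integrable_def)
  define \<phi> where "\<phi> = fourier_transform (cut (1/2))"
  have \<phi>_coeff: "\<phi> (of_int n) = fourier_coeff f n" for n
    unfolding \<phi>_def fourier_transform_cis fourier_coeff_def set_lebesgue_integral_def cut_def cis_conv_exp
    by (simp add: mult_ac)
  have cut_cis: "((\<lambda>x. f x * cis (- (2 * pi * x * y))) has_integral fourier_transform (cut a) y) {-a..a}" for a y
  proof -
    have "integrable lebesgue (\<lambda>x. indicator {-a..a} x *\<^sub>R (f x * cis (- (2 * pi * x * y))))"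
      using integrable_fourier_integrand[OF cut_int, of a y] by (simp add: cut_def)
    then show ?thesis
      using set_lebesgue_integral_eq_integral[of "{-a..a}" "\<lambda>x. f x * cis (- (2 * pi * x * y))"]
      by (simp add: set_integrable_def set_lebesgue_integral_def fourier_transform_cis cut_def has_integral_iff)
  qed
  have kernel: "fourier_transform (cut (real N + 1/2)) y = dirichlet_kernel N y * \<phi> y" for N y
  proof -
    have "((\<lambda>x. f x * cis (- (2 * pi * x * y))) has_integral \<phi> y) {-1/2..1/2}"
      using cut_cis[of y "1/2"] by (simp add: \<phi>_def)
    from has_integral_periods[OF f_periodic this, of N] show ?thesis
      using cut_cis[of y "real N + 1/2"] by (metis has_integral_unique)
  qed
  have lip: "norm (\<phi> y - \<phi> z) \<le> (2 * pi * (1/2) * (LINT x|lebesgue. norm (cut (1/2) x))) * \<bar>y - z\<bar>" for y z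
    unfolding \<phi>_def
    by (rule fourier_transform_lipschitz[OF cut_int]) (auto simp: cut_def indicator_def abs_le_iff split: if_splits)
  have "(\<lambda>N. LINT y|lebesgue. g y * (dirichlet_kernel N y * \<phi> y)) \<longlonglongrightarrow>
      (\<Sum>n\<in>{n::int. \<bar>real_of_int n\<bar> \<le> A}. \<phi> (of_int n) * ((left_lim g (of_int n) + right_lim g (of_int n)) / 2))"
    by (rule dirichlet_kernel_convergence[OF g_integrable supp g_bv lip])
  moreover have "(LINT y|lebesgue. g y * (dirichlet_kernel N y * \<phi> y))
      = integral {- (real N + 1/2)..real N + 1/2} ?h" for N
  proof -
    have "(LINT y|lebesgue. g y * (dirichlet_kernel N y * \<phi> y))
        = (LINT x|lebesgue. cut (real N + 1/2) x * fourier_transform g x)"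
      unfolding kernel[symmetric] by (rule multiplication_formula(2)[OF cut_int g_integrable, symmetric])
    also have "\<dots> = integral {- (real N + 1/2)..real N + 1/2} ?h"
      unfolding cut_h by (rule set_lebesgue_integral_eq_integral(2)[OF h_int, unfolded set_lebesgue_integral_def])
    finally show ?thesis .
  qed
  ultimately have "((\<lambda>R. integral {-R..R} ?h) \<longlongrightarrow>
      (\<Sum>n\<in>{n::int. \<bar>real_of_int n\<bar> \<le> A}. \<phi> (of_int n) * ((left_lim g (of_int n) + right_lim g (of_int n)) / 2))) at_top"
    using h_int by (intro tendsto_symmetric_integral_periodic f_periodic f_integrable riemann_lebesgue g_integrable)
      (auto simp: absolutely_integrable_on_def)
  then show ?thesis
    unfolding has_symmetric_integral_def \<phi>_coeff
    using h_int set_lebesgue_integral_eq_integral(2)[OF h_int] by simp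
qed

end
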